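(* Let $k,d\in\mathbb{N}$, let $U\subseteq F^d$ be open and let $\mu$ be a $k$-friendly measure on $U$. Then the set of $k$-very well approximable points in $U$ has $\mu$-measure zero.
   Context: Let $q$ be a prime power, $\Lambda=\mathbb{F}_q[T]$, $F=\mathbb{F}_q((T^{-1}))$, with $|a|=e^{\deg a}$ for nonzero $a\in F$ ($\deg$ = exponent of the leading term) and $|0|=0$; $F^d$ carries the sup norm. Let $N=\binom{k+d}{d}-1$, the number of nonconstant monomials in $d$ variables of total degree $\leq k$. For $P\in\Lambda[X_1,\dots,X_d]$, $\operatorname{H}(P)$ is the maximum absolute value of the coefficients of $P$. A point $\mathbf{x}\in F^d$ is $k$-very well approximable if for some $\varepsilon>0$, $|P(\mathbf{x})|<\operatorname{H}(P)^{-(N+\varepsilon)}$ for infinitely many $P\in\Lambda[X_1,\dots,X_d]$ of total degree $\leq k$. For a ball $B=B(\mathbf{x};r)$, $3B=B(\mathbf{x};3r)$. Let $\mu$ be a Radon measure on $F^d$ with $\mu(U)>0$. $\mu$ is Federer on $U$ if there is $D>0$ with $\mu(3B)/\mu(B)\leq D$ for every ball $B$ centered in $\operatorname{supp}\mu$ with $3B\subseteq U$. For continuous $f:U\to F$ and $B\subseteq U$, $\|f\|_{\mu,B}=\sup_{\mathbf{x}\in B\cap\operatorname{supp}\mu}|f(\mathbf{x})|$; $f$ is $(C,\alpha)$-good on $U$ w.r.t. $\mu$ if for every ball $B\subseteq U$ centered in $\operatorname{supp}\mu$ and every $\varepsilon>0$, $\mu(\{\mathbf{x}\in B:|f(\mathbf{x})|<\varepsilon\})\leq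 C(\varepsilon/\|f\|_{\mu,B})^\alpha\mu(B)$. A map $\mathbf{f}=(f_1,\dots,f_n):U\to F^n$ is $(C,\alpha)$-good w.r.t. $\mu$ if every $F$-linear combination of $1,f_1,\dots,f_n$ is, and nonplanar w.r.t. $\mu$ if for every ball $B\subseteq U$ centered in $\operatorname{supp}\mu$ the restrictions of $1,f_1,\dots,f_n$ to $B\cap\operatorname{supp}\mu$ are linearly independent over $F$. $\mu$ is $k$-friendly on $U$ if it is Federer on $U$ and the map $\mathbf{f}:U\to F^N$ sending $(x_1,\dots,x_d)$ to the $N$ distinct nonconstant monomials of total degree $\leq k$ is $(C,\alpha)$-good for some $C,\alpha>0$ and nonplanar with respect to $\mu$. *)

theory Defs
  imports
    "HOL-Analysis.Analysis"
    "HOL-Computational_Algebra.Formal_Laurent_Series"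
    "HOL-Library.Poly_Mapping"
begin

text \<open>
  The finite field \<open>\<bbbF>\<^sub>q\<close> is a type \<open>'q\<close> of sort \<open>{finite, field}\<close>, the ring
  \<open>\<Lambda> = \<bbbF>\<^sub>q[T]\<close> is \<open>'q poly\<close>, and \<open>F = \<bbbF>\<^sub>q((T\<^sup>-\<^sup>1))\<close> is \<open>'q fls\<close>: the formal variable
  \<open>fls_X\<close> stands for \<open>T\<^sup>-\<^sup>1\<close>, so that \<open>T\<close> is \<open>fls_X_inv\<close> and \<open>deg a = - fls_subdegree a\<close>.
\<close>

definition F_abs :: "'q::zero fls \<Rightarrow> real" where
  "F_abs a = (if a = 0 then 0 else exp (real_of_int (- fls_subdegree a)))"

definition of_Lambda :: "'q::field poly \<Rightarrow> 'q fls" where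
  "of_Lambda p = (\<Sum>i\<le>Polynomial.degree p. fls_const (coeff p i) * fls_X_inv ^ i)"

text \<open>
  Balls are those of the sup norm coming from \<open>F_abs\<close>, not the library's \<open>ball\<close>, whose metric
  on \<open>'q fls ^ 'd\<close> is an \<open>\<ell>\<^sup>2\<close> combination of coordinatewise metrics with base 2. The topology is
  the same (\<open>open_iff_supball\<close>), so \<open>open\<close>, \<open>compact\<close> and \<open>borel\<close> are the library's.
\<close>

definition supball :: "'q::field fls ^ 'd::finite \<Rightarrow> real \<Rightarrow> ('q fls ^ 'd) set" where
  "supball x r = {y. Max (range (\<lambda>i. F_abs (y $ i - x $ i))) < r}"

lemma supball_iff: "y \<in> supball x r \<longleftrightarrow> (\<forall>i. F_abs (y $ i - x $ i) < r)"
  by (simp add: supball_def)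

text \<open>Polynomials in the variables \<open>X\<^sub>i\<close>, \<open>i \<in> UNIV :: 'd set\<close>, over \<open>\<Lambda>\<close>: finitely supported
  functions from exponent vectors to coefficients.\<close>

type_synonym 'd expo = "'d \<Rightarrow>\<^sub>0 nat"
type_synonym ('q, 'd) mpolyL = "'d expo \<Rightarrow>\<^sub>0 'q poly"

definition expo_deg :: "'d::finite expo \<Rightarrow> nat" where
  "expo_deg m = (\<Sum>i\<in>UNIV. Poly_Mapping.lookup m i)"

definition monom_at :: "'d::finite expo \<Rightarrow> 'q::field fls ^ 'd \<Rightarrow> 'q fls" where
  "monom_at m x = (\<Prod>i\<in>UNIV. x $ i ^ Poly_Mapping.lookup m i)"

definition total_degree_le :: "nat \<Rightarrow> ('q::field, 'd::finite) mpolyL \<Rightarrow> bool" where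
  "total_degree_le k P \<longleftrightarrow> (\<forall>m\<in>Poly_Mapping.keys P. expo_deg m \<le> k)"

definition eval_at :: "('q::field, 'd::finite) mpolyL \<Rightarrow> 'q fls ^ 'd \<Rightarrow> 'q fls" where
  "eval_at P x = (\<Sum>m\<in>Poly_Mapping.keys P. of_Lambda (Poly_Mapping.lookup P m) * monom_at m x)"

text \<open>The range below is a finite set, since almost all coefficients are zero.\<close>

definition height :: "('q::field, 'd::finite) mpolyL \<Rightarrow> real" where
  "height P = Max (range (\<lambda>m. F_abs (of_Lambda (Poly_Mapping.lookup P m))))"

definition num_monoms :: "nat \<Rightarrow> nat \<Rightarrow> nat" where
  "num_monoms k d = ((k + d) choose d) - 1"

definition very_well_approximable :: "nat \<Rightarrow> 'q::{finite,field} fls ^ 'd::finite \<Rightarrow> bool" where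
  "very_well_approximable k x \<longleftrightarrow>
     (\<exists>\<epsilon>>0. infinite {P :: ('q, 'd) mpolyL. total_degree_le k P \<and>
        F_abs (eval_at P x) < height P powr (- (real (num_monoms k CARD('d)) + \<epsilon>))})"

definition radon_measure :: "'a::topological_space measure \<Rightarrow> bool" where
  "radon_measure \<mu> \<longleftrightarrow> sets \<mu> = sets borel \<and>
     (\<forall>K. compact K \<longrightarrow> emeasure \<mu> K < \<infinity>) \<and>
     (\<forall>A\<in>sets borel. emeasure \<mu> A = (SUP K\<in>{K. compact K \<and> K \<subseteq> A}. emeasure \<mu> K))"

definition msupp :: "'a::topological_space measure \<Rightarrow> 'a set" where
  "msupp \<mu> = {x. \<forall>V. open V \<and> x \<in> V \<longrightarrow> emeasure \<mu> V > 0}"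

definition federer_on :: "('q::field fls ^ 'd::finite) set \<Rightarrow> ('q fls ^ 'd) measure \<Rightarrow> bool" where
  "federer_on U \<mu> \<longleftrightarrow>
     (\<exists>D::real. D > 0 \<and>
       (\<forall>x\<in>msupp \<mu>. \<forall>r>0. supball x (3 * r) \<subseteq> U \<longrightarrow>
          emeasure \<mu> (supball x (3 * r)) / emeasure \<mu> (supball x r) \<le> ennreal D))"

definition norm_on ::
  "('q::field fls ^ 'd::finite) measure \<Rightarrow> ('q fls ^ 'd) set \<Rightarrow> ('q fls ^ 'd \<Rightarrow> 'q fls) \<Rightarrow> real" where
  "norm_on \<mu> B f = (SUP x\<in>B \<inter> msupp \<mu>. F_abs (f x))"

text \<open>If \<open>norm_on \<mu> B f = 0\<close>, then \<open>\<epsilon> / norm_on \<mu> B f\<close> is to be read as \<open>\<infinity>\<close> and the inequality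
  is void, whereas division by zero in type \<open>real\<close> would give \<open>0\<close>; hence the guard.
  The supremum in \<open>norm_on\<close> is finite for continuous \<open>f\<close>, since \<open>B\<close> is compact.\<close>

definition good_fun ::
  "real \<Rightarrow> real \<Rightarrow> ('q::field fls ^ 'd::finite) set \<Rightarrow> ('q fls ^ 'd) measure
     \<Rightarrow> ('q fls ^ 'd \<Rightarrow> 'q fls) \<Rightarrow> bool" where
  "good_fun C \<alpha> U \<mu> f \<longleftrightarrow> continuous_on U f \<and>
     (\<forall>x\<in>msupp \<mu>. \<forall>r>0. \<forall>\<epsilon>>0. supball x r \<subseteq> U \<longrightarrow> norm_on \<mu> (supball x r) f \<noteq> 0 \<longrightarrow>
        emeasure \<mu> {y \<in> supball x r. F_abs (f y) < \<epsilon>}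
          \<le> ennreal (C * (\<epsilon> / norm_on \<mu> (supball x r) f) powr \<alpha>) * emeasure \<mu> (supball x r))"

text \<open>Maps into \<open>F\<^sup>n\<close> are given as families of coordinate functions with a finite index set \<open>I\<close>.\<close>

definition good_map ::
  "real \<Rightarrow> real \<Rightarrow> ('q::field fls ^ 'd::finite) set \<Rightarrow> ('q fls ^ 'd) measure
     \<Rightarrow> 'i set \<Rightarrow> ('i \<Rightarrow> 'q fls ^ 'd \<Rightarrow> 'q fls) \<Rightarrow> bool" where
  "good_map C \<alpha> U \<mu> I f \<longleftrightarrow>
     (\<forall>c0 c. good_fun C \<alpha> U \<mu> (\<lambda>x. c0 + (\<Sum>i\<in>I. c i * f i x)))"

definition nonplanar_map ::
  "('q::field fls ^ 'd::finite) set \<Rightarrow> ('q fls ^ 'd) measure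
     \<Rightarrow> 'i set \<Rightarrow> ('i \<Rightarrow> 'q fls ^ 'd \<Rightarrow> 'q fls) \<Rightarrow> bool" where
  "nonplanar_map U \<mu> I f \<longleftrightarrow>
     (\<forall>x\<in>msupp \<mu>. \<forall>r>0. supball x r \<subseteq> U \<longrightarrow>
        (\<forall>c0 c. (\<forall>y\<in>supball x r \<inter> msupp \<mu>. c0 + (\<Sum>i\<in>I. c i * f i y) = 0)
                  \<longrightarrow> c0 = 0 \<and> (\<forall>i\<in>I. c i = 0)))"

definition nonconst_expos :: "nat \<Rightarrow> 'd::finite expo set" where
  "nonconst_expos k = {m. 1 \<le> expo_deg m \<and> expo_deg m \<le> k}"

definition friendly_on ::
  "nat \<Rightarrow> ('q::{finite,field} fls ^ 'd::finite) set \<Rightarrow> ('q fls ^ 'd) measure \<Rightarrow> bool" where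
  "friendly_on k U \<mu> \<longleftrightarrow> federer_on U \<mu> \<and>
     (\<exists>C>0. \<exists>\<alpha>>0. good_map C \<alpha> U \<mu> (nonconst_expos k) monom_at) \<and>
     nonplanar_map U \<mu> (nonconst_expos k) monom_at"

lemma F_abs_less_exp_iff:
  "F_abs a < exp (- real n) \<longleftrightarrow> a = 0 \<or> int n < fls_subdegree a"
  by (auto simp: F_abs_def)

lemma dist_fls_less_iff:
  "dist a (b :: 'q::field fls) < inverse (2 ^ n) \<longleftrightarrow> a - b = 0 \<or> int n < fls_subdegree (a - b)"
proof -
  have "inverse (2 ^ m) < (inverse (2 ^ n) :: real) \<longleftrightarrow> n < m" for m
    by simp
  moreover have "\<not> (2 ^ m < (inverse (2 ^ n) :: real))" for m :: nat
    by (smt (verit) inverse_le_1_iff one_le_power)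
  ultimately show ?thesis
    by (auto simp: dist_fls_def)
qed

lemma open_iff_supball:
  fixes S :: "('q::field fls ^ 'd::finite) set"
  shows "open S \<longleftrightarrow> (\<forall>x\<in>S. \<exists>r>0. supball x r \<subseteq> S)"
proof
  assume S: "open S"
  show "\<forall>x\<in>S. \<exists>r>0. supball x r \<subseteq> S"
  proof
    fix x assume "x \<in> S"
    with S obtain A where A: "\<And>i. open (A i)" "\<And>i. x $ i \<in> A i"
      and AS: "\<And>y. (\<forall>i. y $ i \<in> A i) \<Longrightarrow> y \<in> S"
      unfolding open_vec_def by metis
    have "\<exists>n. \<forall>a. dist a (x $ i) < inverse (2 ^ n) \<longrightarrow> a \<in> A i" for i
    proof -
      obtain e where e: "e > 0" "\<And>a. dist a (x $ i) < e \<Longrightarrow> a \<in> A i"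
        using A[of i] unfolding open_dist by blast
      obtain n where "inverse 2 ^ n < e"
        using real_arch_pow_inv[of e "inverse 2"] e(1) by auto
      with e(2) show ?thesis
        by (metis less_trans power_inverse)
    qed
    then obtain n where n: "\<And>i a. dist a (x $ i) < inverse (2 ^ n i) \<Longrightarrow> a \<in> A i"
      by metis
    define m where "m = Max (range n)"
    have m: "n i \<le> m" for i
      by (simp add: m_def)
    have "supball x (exp (- real m)) \<subseteq> S"
    proof
      fix y assume y: "y \<in> supball x (exp (- real m))"
      have "y $ i \<in> A i" for i
        using y m[of i] unfolding supball_iff F_abs_less_exp_iff
        by (intro n) (force simp: dist_fls_less_iff)
      then show "y \<in> S" by (intro AS) auto
    qed
    then show "\<exists>r>0. supball x r \<subseteq> S"
      by (intro exI[of _ "exp (- real m)"]) auto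
  qed
next
  assume S: "\<forall>x\<in>S. \<exists>r>0. supball x r \<subseteq> S"
  show "open S"
    unfolding open_dist
  proof
    fix x assume "x \<in> S"
    with S obtain r where r: "r > 0" "supball x r \<subseteq> S" by blast
    obtain n where "inverse (exp 1) ^ n < r"
      using real_arch_pow_inv[of r "inverse (exp 1)"] r(1)
      by (auto simp: inverse_less_1_iff)
    then have n: "exp (- real n) < r"
      by (simp add: power_inverse exp_minus exp_of_nat_mult[symmetric])
    have "y \<in> S" if y: "dist y x < inverse (2 ^ n)" for y
    proof -
      have "F_abs (y $ i - x $ i) < r" for i
      proof -
        have "dist (y $ i) (x $ i) < inverse (2 ^ n)"
          using dist_vec_nth_le[of y i x] y by linarith
        then have "F_abs (y $ i - x $ i) < exp (- real n)"
          unfolding F_abs_less_exp_iff dist_fls_less_iff .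
        with n show ?thesis by simp
      qed
      with r(2) show ?thesis by (auto simp: supball_iff)
    qed
    then show "\<exists>e>0. \<forall>y. dist y x < e \<longrightarrow> y \<in> S"
      by (intro exI[of _ "inverse (2 ^ n)"]) auto
  qed
qed

end

theory Submission
  imports Defs "Jordan_Normal_Form.Determinant" "HOL-Real_Asymp.Real_Asymp"
begin

no_notation vec_index (infixl "$" 100)

text \<open>
  By the Dani correspondence, a polynomial \<open>P\<close> with \<open>|P(x)| < H(P)\<^bsup>-(N+\<epsilon>)\<^esup>\<close> gives an integral vector which
  is contracted to norm \<open>e\<^bsup>-s\<^esup>\<close>, with \<open>s\<close> proportional to \<open>log H(P)\<close>, when its value at \<open>x\<close> is multiplied by \<open>T\<^bsup>Nt\<^esup>\<close>
  and its coefficients by \<open>T\<^bsup>-t\<^esup>\<close>. It is therefore enough to bound the measure of the points whose twisted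
  lattice has a vector shorter than \<open>\<epsilon>\<close> by a constant times \<open>\<epsilon>\<^bsup>\<alpha>\<^esup>\<close>, uniformly in \<open>t\<close>, and to apply
  Borel--Cantelli.

  The bound is the quantitative nondivergence theorem of Kleinbock and Margulis. The covolume of a
  rational subspace is, as a function of \<open>x\<close>, a maximum of absolute values of \<open>F\<close>-linear combinations
  of monomials, hence good, and by nonplanarity it is large somewhere on the ball. Since \<open>F\<^sup>d\<close> is
  ultrametric, the balls that occur in the induction on flags are nested or disjoint, so no covering
  theorem is needed and the Federer condition is used only to pass from a ball to the next larger one.
\<close>

section \<open>The absolute value and the integers\<close>

text \<open>The lower bound for covolumes is uniform in \<open>t\<close> because of the exponents.
  Let \<open>n + 1\<close> be the number of monomials, constant included. Replacing one row of a
  nonzero integral minor of size \<open>j\<close> by the row of values at \<open>x\<close> gives a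
  combination of monomials with a coefficient of size at least \<open>e^(n t - (j - 1) t)\<close>,
  and \<open>j - 1\<close> is at most \<open>n\<close>. Nonplanarity, made quantitative through
  finitely many points of the support, turns such a coefficient into a value of at least \<rho>
  somewhere on the ball, with \<rho> independent of \<open>t\<close>.

  The obstacle is that infinitely many subspaces compete at each point. Since radii are discrete and
  bounded by that of the starting ball, a largest ball on which some covolume stays below \<rho>
  still exists, and the induction runs over the finitely many ranks. Measurability of the
  exceptional sets is avoided by estimating measurable sets that contain them.

  A good integral basis of a subspace is found by minimising a minor, so that no structure theory of
  lattices over \<open>\<Lambda>\<close> enters.\<close>

lemma F_abs_zero [simp]: "F_abs 0 = 0"
  by (simp add: F_abs_def)

lemma F_abs_nonneg [simp]: "F_abs a \<ge> 0"
  by (simp add: F_abs_def)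

lemma F_abs_eq_0_iff [simp]: "F_abs a = 0 \<longleftrightarrow> a = 0"
  by (simp add: F_abs_def)

lemma F_abs_pos_iff [simp]: "0 < F_abs a \<longleftrightarrow> a \<noteq> 0"
  by (simp add: F_abs_def)

lemma F_abs_one [simp]: "F_abs (1 :: 'a::field fls) = 1"
  by (simp add: F_abs_def)

lemma F_abs_minus [simp]: "F_abs (- a) = F_abs (a :: 'a::field fls)"
  by (simp add: F_abs_def)

lemma F_abs_minus_commute: "F_abs (a - b) = F_abs (b - a :: 'a::field fls)"
  by (metis F_abs_minus minus_diff_eq)

lemma F_abs_mult: "F_abs (a * b) = F_abs a * F_abs (b :: 'a::field fls)"
  by (simp add: F_abs_def exp_add[symmetric])

lemma F_abs_power: "F_abs (a ^ n) = F_abs (a :: 'a::field fls) ^ n"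
  by (induction n) (simp_all add: F_abs_mult)

lemma F_abs_inverse: "F_abs (inverse a) = inverse (F_abs (a :: 'a::field fls))"
proof (cases "a = 0")
  case False
  then have "F_abs (inverse a) * F_abs a = 1"
    by (simp flip: F_abs_mult)
  with False show ?thesis
    by (simp add: field_simps)
qed simp

lemma F_abs_divide: "F_abs (a / b) = F_abs a / F_abs (b :: 'a::field fls)"
  by (simp add: divide_inverse F_abs_mult F_abs_inverse)

lemma F_abs_add_le: "F_abs (a + b) \<le> max (F_abs a) (F_abs (b :: 'a::field fls))"
proof (cases "a = 0 \<or> b = 0 \<or> a + b = 0")
  case False
  then have "min (fls_subdegree a) (fls_subdegree b) \<le> fls_subdegree (a + b)"
    by (intro fls_plus_subdegree) auto
  with False show ?thesis
    by (auto simp: F_abs_def max_def min_def split: if_splits)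
qed (auto simp: le_max_iff_disj)

lemma F_abs_sum_le:
  fixes f :: "'i \<Rightarrow> 'a::field fls"
  assumes "\<And>i. i \<in> A \<Longrightarrow> F_abs (f i) \<le> c" and "c \<ge> 0"
  shows "F_abs (\<Sum>i\<in>A. f i) \<le> c"
  using assms(1)
proof (induction A rule: infinite_finite_induct)
  case (insert x A)
  then have "max (F_abs (f x)) (F_abs (\<Sum>i\<in>A. f i)) \<le> c"
    by simp
  then have "F_abs (f x + (\<Sum>i\<in>A. f i)) \<le> c"
    using F_abs_add_le[of "f x" "\<Sum>i\<in>A. f i"] by linarith
  with insert(1,2) show ?case
    by simp
qed (use assms(2) in auto)

lemma F_abs_add_eq:
  assumes "F_abs a < F_abs (b :: 'a::field fls)"
  shows "F_abs (a + b) = F_abs b"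
proof (rule antisym)
  show "F_abs (a + b) \<le> F_abs b"
    using F_abs_add_le[of a b] assms by simp
  show "F_abs b \<le> F_abs (a + b)"
    using F_abs_add_le[of "a + b" "- a"] assms by simp
qed

lemma F_abs_fls_X: "F_abs (fls_X :: 'a::field fls) = exp (- 1)"
  by (simp add: F_abs_def)

lemma F_abs_fls_X_inv: "F_abs (fls_X_inv :: 'a::field fls) = exp 1"
  by (simp add: F_abs_def)

text \<open>The nonzero absolute values are the integral powers of \<open>e\<close>, so none lies
  strictly between \<open>e^n\<close> and \<open>e^(n+1)\<close>. This makes open and closed balls
  interchangeable.\<close>

lemma F_abs_less_iff_le:
  assumes "exp (real_of_int n) < c" "c \<le> exp (real_of_int n + 1)"
  shows "F_abs a < c \<longleftrightarrow> F_abs (a :: 'a::field fls) \<le> exp (real_of_int n)"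
proof (cases "a = 0")
  case False
  have "F_abs a \<le> exp (real_of_int n)" if "F_abs a < c"
  proof -
    from that assms(2) have "F_abs a < exp (real_of_int n + 1)"
      by linarith
    then have "- fls_subdegree a < n + 1"
      using False unfolding F_abs_def by simp
    with False show ?thesis
      unfolding F_abs_def by simp
  qed
  with assms(1) show ?thesis
    by auto
qed (use less_trans[OF exp_gt_zero assms(1)] in auto)

lemma exp_neg_less:
  assumes "c > 0"
  obtains n :: nat where "exp (- real n) < c"
proof -
  obtain n where "inverse (exp 1) ^ n < c"
    using real_arch_pow_inv[of c "inverse (exp 1)"] assms by (auto simp: inverse_less_1_iff)
  then have "exp (- real n) < c"
    by (simp add: power_inverse exp_minus exp_of_nat_mult[symmetric])
  with that show thesis .
qed

lemma open_F_abs_less: "open {a :: 'a::field fls. F_abs a < c}"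
  unfolding open_fls_def
proof clarify
  fix a :: "'a fls" assume a: "F_abs a < c"
  then have "c > 0"
    using F_abs_nonneg[of a] by linarith
  obtain n :: nat where n: "exp (- real n) < c"
    using exp_neg_less[OF \<open>c > 0\<close>] .
  have "F_abs y < c" if "dist y a < inverse (2 ^ n)" for y
  proof -
    have "F_abs (y - a) < exp (- real n)"
      using that unfolding F_abs_less_exp_iff dist_fls_less_iff .
    then show ?thesis
      using F_abs_add_le[of "y - a" a] n a by auto
  qed
  then show "\<exists>r>0. {y. dist y a < r} \<subseteq> {a. F_abs a < c}"
    by (intro exI[of _ "inverse (2 ^ n)"]) auto
qed

section \<open>The embedding of the polynomial ring into \<open>F\<close>\<close>

lemma of_Lambda_altdef: "of_Lambda p = poly (map_poly fls_const p) fls_X_inv"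
  by (simp add: of_Lambda_def poly_altdef degree_map_poly coeff_map_poly)

lemma of_Lambda_0 [simp]: "of_Lambda 0 = 0"
  by (simp add: of_Lambda_altdef)

lemma of_Lambda_pCons: "of_Lambda (pCons a p) = fls_const a + fls_X_inv * of_Lambda p"
  by (simp add: of_Lambda_altdef map_poly_pCons)

lemma of_Lambda_1 [simp]: "of_Lambda 1 = 1"
  by (simp add: one_pCons of_Lambda_pCons)

lemma of_Lambda_add: "of_Lambda (p + q) = of_Lambda p + of_Lambda q"
  by (induction p q rule: poly_induct2)
    (simp_all add: of_Lambda_pCons fls_plus_const algebra_simps flip: fls_plus_const)

lemma of_Lambda_smult: "of_Lambda (Polynomial.smult c p) = fls_const c * of_Lambda p"
  by (induction p) (simp_all add: of_Lambda_pCons algebra_simps flip: fls_const_mult_const)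

lemma of_Lambda_mult: "of_Lambda (p * q) = of_Lambda p * of_Lambda q"
  by (induction p) (simp_all add: of_Lambda_pCons of_Lambda_add of_Lambda_smult algebra_simps)

lemma of_Lambda_uminus: "of_Lambda (- p) = - of_Lambda p"
  by (metis add_eq_0_iff of_Lambda_0 of_Lambda_add right_minus)

lemma F_abs_const_le: "F_abs (fls_const a) \<le> 1"
  by (cases "a = 0") (simp_all add: F_abs_def)

lemma F_abs_of_Lambda: "p \<noteq> 0 \<Longrightarrow> F_abs (of_Lambda p) = exp (real (Polynomial.degree p))"
proof (induction p)
  case (pCons a p)
  show ?case
  proof (cases "p = 0")
    case True
    with pCons show ?thesis
      by (simp add: of_Lambda_pCons F_abs_def)
  next
    case False
    have *: "F_abs (fls_X_inv * of_Lambda p) = exp (1 + real (Polynomial.degree p))"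
      using False pCons.IH by (simp add: F_abs_mult F_abs_fls_X_inv exp_add)
    have "F_abs (fls_const a) < exp (1 + real (Polynomial.degree p))"
      by (rule le_less_trans[OF F_abs_const_le]) simp
    with * show ?thesis
      using False by (simp add: of_Lambda_pCons F_abs_add_eq)
  qed
qed simp

lemma of_Lambda_eq_0_iff [simp]: "of_Lambda p = 0 \<longleftrightarrow> p = 0"
  by (metis F_abs_eq_0_iff F_abs_of_Lambda exp_not_eq_zero of_Lambda_0)

lemma range_of_Lambda_add:
  "a \<in> range of_Lambda \<Longrightarrow> b \<in> range of_Lambda \<Longrightarrow> a + b \<in> range of_Lambda"
  by (metis (no_types, lifting) imageE of_Lambda_add rangeI)

lemma range_of_Lambda_mult:
  "a \<in> range of_Lambda \<Longrightarrow> b \<in> range of_Lambda \<Longrightarrow> a * b \<in> range of_Lambda"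
  by (metis (no_types, lifting) imageE of_Lambda_mult rangeI)

lemma range_of_Lambda_0: "0 \<in> range of_Lambda"
  by (metis of_Lambda_0 rangeI)

lemma range_of_Lambda_1: "1 \<in> range of_Lambda"
  by (metis of_Lambda_1 rangeI)

lemma range_of_Lambda_uminus: "a \<in> range of_Lambda \<Longrightarrow> - a \<in> range of_Lambda"
  by (metis (no_types, lifting) imageE of_Lambda_uminus rangeI)

lemma range_of_Lambda_sum:
  "(\<And>i. i \<in> A \<Longrightarrow> f i \<in> range of_Lambda) \<Longrightarrow> (\<Sum>i\<in>A. f i) \<in> range of_Lambda"
  by (induction A rule: infinite_finite_induct) (simp_all add: range_of_Lambda_add range_of_Lambda_0)

lemma range_of_Lambda_prod:
  "(\<And>i. i \<in> A \<Longrightarrow> f i \<in> range of_Lambda) \<Longrightarrow> (\<Prod>i\<in>A. f i) \<in> range of_Lambda"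
  by (induction A rule: infinite_finite_induct) (simp_all add: range_of_Lambda_mult range_of_Lambda_1)

text \<open>Discreteness of the integers: a nonzero integral element has absolute value at least 1.
  Every lower bound for covolumes rests on this.\<close>

lemma F_abs_range_of_Lambda:
  assumes "a \<in> range of_Lambda" "a \<noteq> 0"
  obtains m :: nat where "F_abs a = exp (real m)"
  using assms F_abs_of_Lambda by force

section \<open>Balls, support and good functions\<close>

text \<open>Integral logarithmic radii make the balls around a point a chain indexed by
  \<open>int\<close>; every \<open>supball\<close> of positive radius is one of them.\<close>

definition expball :: "'q::field fls ^ 'd::finite \<Rightarrow> int \<Rightarrow> ('q fls ^ 'd) set" where
  "expball x n = {y. \<forall>i. F_abs (y $ i - x $ i) \<le> exp (real_of_int n)}"

lemma expball_self: "x \<in> expball x n"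
  by (simp add: expball_def)

lemma expball_subset:
  assumes "y \<in> expball x n"
  shows "expball y n \<subseteq> expball x n"
proof
  fix z assume z: "z \<in> expball y n"
  have "F_abs (z $ i - x $ i) \<le> exp (real_of_int n)" for i
    using F_abs_add_le[of "z $ i - y $ i" "y $ i - x $ i"] z assms
    by (auto simp: expball_def intro: order_trans)
  then show "z \<in> expball x n"
    by (simp add: expball_def)
qed

lemma expball_sym: "y \<in> expball x n \<Longrightarrow> x \<in> expball y n"
  by (simp add: expball_def F_abs_minus_commute)

lemma expball_eq: "y \<in> expball x n \<Longrightarrow> expball y n = expball x n"
  by (rule equalityI[OF expball_subset expball_subset[OF expball_sym]])

lemma expball_mono: "n \<le> m \<Longrightarrow> expball x n \<subseteq> expball x m"
proof
  fix y assume "n \<le> m" and y: "y \<in> expball x n"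
  then have "exp (real_of_int n) \<le> exp (real_of_int m)"
    by simp
  with y show "y \<in> expball x m"
    unfolding expball_def by (auto intro: order_trans)
qed

lemma supball_eq_expball:
  assumes "exp (real_of_int n) < c" "c \<le> exp (real_of_int n + 1)"
  shows "supball x c = expball x n"
  by (simp add: set_eq_iff supball_iff expball_def F_abs_less_iff_le[OF assms])

lemma expball_eq_supball: "expball x n = supball x (6 / 5 * exp (real_of_int n))"
proof (rule supball_eq_expball[symmetric])
  show "6 / 5 * exp (real_of_int n) \<le> exp (real_of_int n + 1)"
    using exp_ge_add_one_self[of 1] by (simp add: exp_add)
qed simp

text \<open>The factor \<open>6/5\<close> makes the dilation by \<open>3\<close> advance the radius by exactly one step.\<close>

lemma expball_Suc_eq_supball: "expball x (n + 1) = supball x (3 * (6 / 5 * exp (real_of_int n)))"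
proof (rule supball_eq_expball[symmetric])
  show "exp (real_of_int (n + 1)) < 3 * (6 / 5 * exp (real_of_int n))"
    using e_less_272 by (simp add: exp_add)
  have "(2::real) * 2 \<le> exp 1 * exp 1"
    using exp_ge_add_one_self[of 1] by (intro mult_mono) auto
  then have "3 * (6 / 5) * exp (real_of_int n) \<le> (exp 1 * exp 1) * exp (real_of_int n)"
    by (intro mult_right_mono) auto
  moreover have "exp (real_of_int (n + 1) + 1) = exp 1 * exp 1 * exp (real_of_int n)"
    unfolding exp_add[symmetric] by (simp add: add_ac)
  ultimately show "3 * (6 / 5 * exp (real_of_int n)) \<le> exp (real_of_int (n + 1) + 1)"
    by (simp only: mult.assoc)
qed

lemma open_expball: "open (expball x n)"
  unfolding open_iff_supball
proof
  fix y assume "y \<in> expball x n"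
  then have "supball y (6 / 5 * exp (real_of_int n)) \<subseteq> expball x n"
    unfolding expball_eq_supball[symmetric] by (rule expball_subset)
  then show "\<exists>r>0. supball y r \<subseteq> expball x n"
    by (intro exI[of _ "6 / 5 * exp (real_of_int n)"]) auto
qed

lemma open_contains_expball:
  fixes S :: "('q::field fls ^ 'd::finite) set"
  assumes "open S" "x \<in> S"
  obtains n :: nat where "expball x (- int n) \<subseteq> S"
proof -
  obtain r where r: "r > 0" "supball x r \<subseteq> S"
    using assms open_iff_supball by blast
  obtain n :: nat where "exp (- real n) < r"
    using exp_neg_less[OF r(1)] .
  then have "expball x (- int n) \<subseteq> supball x r"
    by (auto simp: expball_def supball_iff) (meson le_less_trans)
  with r(2) that show thesis by blast
qed

text \<open>The coefficient with index \<open>k\<close> belongs to \<open>T\<close> to the power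
  \<open>-k\<close>, so a bound on the absolute value is the vanishing of an initial segment of
  coefficients.\<close>

lemma F_abs_le_exp_iff:
  "F_abs a \<le> exp (real_of_int n) \<longleftrightarrow> (\<forall>k < - n. fls_nth (a :: 'a::field fls) k = 0)"
proof (cases "a = 0")
  case False
  have "- fls_subdegree a \<le> n \<longleftrightarrow> (\<forall>k < - n. fls_nth a k = 0)"
    using False fls_subdegree_geI[of a "- n"] fls_eq0_below_subdegree[of _ a] by fastforce
  moreover have "F_abs a \<le> exp (real_of_int n) \<longleftrightarrow> - fls_subdegree a \<le> n"
    using False unfolding F_abs_def by (simp flip: of_int_minus)
  ultimately show ?thesis
    by simp
qed simp

text \<open>The remaining free coefficients range over a finite field, so the ball is a continuous
  image of a product of finite discrete spaces, which is compact by Tychonoff.\<close>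

lemma compact_expball:
  fixes x :: "'q::{finite,field} fls ^ 'd::finite"
  shows "compact (expball x n)"
proof -
  define T where "T = product_topology (\<lambda>_::'d \<times> nat. discrete_topology (UNIV :: 'q set)) UNIV"
  define G :: "('d \<times> nat \<Rightarrow> 'q) \<Rightarrow> 'q fls ^ 'd" where
    "G g = (\<chi> i. x $ i + fls_shift n (fps_to_fls (Abs_fps (\<lambda>j. g (i, j)))))" for g
  have topspace: "topspace T = UNIV"
    by (simp add: T_def)
  have "compact_space T"
    unfolding T_def by (intro compact_space_product_topology[THEN iffD2] disjI2)
      (simp add: compact_space_discrete_topology)
  then have compactin: "compactin T UNIV"
    by (simp add: compact_space_def topspace)
  have nth: "fls_nth (G g $ i) k = fls_nth (x $ i) k + (if k + n < 0 then 0 else g (i, nat (k + n)))"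
    for g i k
    by (simp add: G_def)
  have image: "G ` UNIV = expball x n"
  proof (intro equalityI subsetI)
    fix y assume "y \<in> G ` UNIV"
    then show "y \<in> expball x n"
      by (auto simp: expball_def F_abs_le_exp_iff nth)
  next
    fix y assume y: "y \<in> expball x n"
    have "y = G (\<lambda>(i, j). fls_nth (y $ i - x $ i) (int j - n))"
      unfolding Finite_Cartesian_Product.vec_eq_iff
    proof (intro allI fls_eqI)
      fix i k
      show "fls_nth (y $ i) k = fls_nth (G (\<lambda>(i, j). fls_nth (y $ i - x $ i) (int j - n)) $ i) k"
        using y unfolding expball_def F_abs_le_exp_iff nth by auto
    qed
    then show "y \<in> G ` UNIV" by blast
  qed
  have "continuous_map T euclidean G"
    unfolding continuous_map_def
  proof (intro conjI allI impI)
    fix S :: "('q fls ^ 'd) set" assume "openin euclidean S"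
    then have S: "open S" by simp
    show "openin T {g \<in> topspace T. G g \<in> S}"
    proof (subst openin_subopen, intro ballI)
      fix g assume "g \<in> {g \<in> topspace T. G g \<in> S}"
      then obtain m :: nat where m: "expball (G g) (- int m) \<subseteq> S"
        using open_contains_expball[OF S] by auto
      \<comment> \<open>Being within \<open>e^(-m)\<close> of \<open>G g\<close> depends on the
        coefficients below index \<open>m\<close> only. After the shift by \<open>n\<close> these
        are the finitely many coordinates \<open>j < m + n\<close>.\<close>
      define V where "V = PiE UNIV (\<lambda>(i, j). if int j < int m + n then {g (i, j)} else UNIV)"
      have "finite {p :: 'd \<times> nat. (case p of (i, j) \<Rightarrow> if int j < int m + n then {g (i, j)} else UNIV) \<noteq> UNIV}"
        by (rule finite_subset[of _ "UNIV \<times> {..nat (int m + n)}"]) (auto split: if_splits)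
      then have "openin T V"
        unfolding T_def V_def openin_PiE_gen by simp
      moreover have "g \<in> V"
        by (auto simp: V_def)
      moreover have "V \<subseteq> {g \<in> topspace T. G g \<in> S}"
      proof
        fix h assume h: "h \<in> V"
        have hg: "h (i, j) = g (i, j)" if "int j < int m + n" for i j
          using h that unfolding V_def PiE_iff by (force split: if_splits)
        have "G h \<in> expball (G g) (- int m)"
          unfolding expball_def F_abs_le_exp_iff by (auto simp: nth hg)
        with m show "h \<in> {g \<in> topspace T. G g \<in> S}"
          by (auto simp: topspace)
      qed
      ultimately show "\<exists>V. openin T V \<and> g \<in> V \<and> V \<subseteq> {g \<in> topspace T. G g \<in> S}"
        by blast
    qed
  qed simp
  from image_compactin[OF compactin this] show ?thesis
    by (simp add: image)
qed

text \<open>A finite subcover already contains every ball of this radius, since a ball equals any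
  ball of the same radius that contains its centre.\<close>

lemma finite_expball_subballs:
  fixes x :: "'q::{finite,field} fls ^ 'd::finite"
  shows "finite {expball y l |y. y \<in> expball x n}"
proof -
  obtain Z where Z: "Z \<subseteq> expball x n" "finite Z" "expball x n \<subseteq> (\<Union>y\<in>Z. expball y l)"
    by (rule compactE_image[OF compact_expball[of x n], of "expball x n" "\<lambda>y. expball y l"])
      (auto intro: open_expball expball_self)
  have "{expball y l |y. y \<in> expball x n} \<subseteq> (\<lambda>y. expball y l) ` Z"
  proof clarify
    fix y assume "y \<in> expball x n"
    with Z(3) obtain w where "w \<in> Z" "y \<in> expball w l"
      by blast
    then show "expball y l \<in> (\<lambda>y. expball y l) ` Z"
      by (auto dest: expball_eq)
  qed
  with Z(2) show ?thesis
    by (meson finite_imageI finite_subset)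
qed

text \<open>Inner regularity reduces the claim to compact subsets, which finitely many of the
  neighbourhoods cover.\<close>

lemma radon_measure_locally_null:
  assumes "radon_measure \<mu>" "A \<in> sets borel"
    and "\<And>x. x \<in> A \<Longrightarrow> \<exists>V. open V \<and> x \<in> V \<and> emeasure \<mu> (A \<inter> V) = 0"
  shows "emeasure \<mu> A = 0"
proof -
  have sets: "sets \<mu> = sets borel"
    using assms(1) by (simp add: radon_measure_def)
  have "emeasure \<mu> K = 0" if K: "compact K" "K \<subseteq> A" for K
  proof -
    obtain V where V: "\<And>x. x \<in> A \<Longrightarrow> open (V x) \<and> x \<in> V x \<and> emeasure \<mu> (A \<inter> V x) = 0"
      using assms(3) by metis
    obtain Z where Z: "Z \<subseteq> K" "finite Z" "K \<subseteq> (\<Union>x\<in>Z. V x)"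
      by (rule compactE_image[OF K(1), of K V]) (use V K(2) in blast)+
    have null: "A \<inter> V x \<in> null_sets \<mu>" if "x \<in> Z" for x
      using V[of x] Z(1) K(2) that assms(2) by (auto simp: null_sets_def sets)
    have "(\<Union>x\<in>Z. A \<inter> V x) \<in> null_sets \<mu>"
      using Z(2) null by (rule null_sets.finite_UN)
    moreover have "emeasure \<mu> K \<le> emeasure \<mu> (\<Union>x\<in>Z. A \<inter> V x)"
      using Z(3) K(2) calculation by (intro emeasure_mono) auto
    ultimately show ?thesis
      by auto
  qed
  then have "(SUP K\<in>{K. compact K \<and> K \<subseteq> A}. emeasure \<mu> K) \<le> 0"
    by (intro SUP_least) auto
  then show ?thesis
    using assms(1,2) by (simp add: radon_measure_def)
qed

lemma open_Compl_msupp: "open (- msupp \<mu>)"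
  unfolding open_subopen[of "- msupp \<mu>"] by (fastforce simp: msupp_def)

lemma radon_measure_off_msupp:
  assumes "radon_measure \<mu>" "B \<in> sets borel"
  shows "emeasure \<mu> (B - msupp \<mu>) = 0"
proof (rule radon_measure_locally_null[OF assms(1)])
  have sets: "sets \<mu> = sets borel"
    using assms(1) by (simp add: radon_measure_def)
  have "B - msupp \<mu> = B \<inter> - msupp \<mu>" by blast
  then show "B - msupp \<mu> \<in> sets borel"
    using assms(2) open_Compl_msupp[of \<mu>] by simp
  fix x assume "x \<in> B - msupp \<mu>"
  then obtain V where V: "open V" "x \<in> V" "emeasure \<mu> V = 0"
    by (auto simp: msupp_def not_gr_zero)
  have "emeasure \<mu> ((B - msupp \<mu>) \<inter> V) \<le> emeasure \<mu> V"
    using V(1) by (intro emeasure_mono) (auto simp: sets)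
  with V show "\<exists>V. open V \<and> x \<in> V \<and> emeasure \<mu> ((B - msupp \<mu>) \<inter> V) = 0"
    by (intro exI[of _ V]) auto
qed

lemma open_F_abs_sublevel:
  fixes f :: "'x::topological_space \<Rightarrow> 'a::field fls"
  assumes "continuous_on U f" "open U"
  shows "open {x \<in> U. F_abs (f x) < c}"
proof -
  have "open (f -` {a. F_abs a < c} \<inter> U)"
    by (rule continuous_on_open_vimage[OF assms(2), THEN iffD1, OF assms(1), rule_format,
          OF open_F_abs_less])
  moreover have "f -` {a. F_abs a < c} \<inter> U = {x \<in> U. F_abs (f x) < c}"
    by auto
  ultimately show ?thesis by simp
qed

lemma compact_F_abs_bounded:
  fixes f :: "'x::topological_space \<Rightarrow> 'a::field fls"
  assumes "continuous_on U f" "open U" "compact K" "K \<subseteq> U"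
  obtains c where "\<And>x. x \<in> K \<Longrightarrow> F_abs (f x) \<le> c"
proof -
  obtain M where M: "finite M" "K \<subseteq> (\<Union>m\<in>M. {x \<in> U. F_abs (f x) < real m})"
  proof (rule compactE_image[OF assms(3), of UNIV "\<lambda>m. {x \<in> U. F_abs (f x) < real m}"])
    show "K \<subseteq> (\<Union>m. {x \<in> U. F_abs (f x) < real m})"
      using assms(4) reals_Archimedean2 by blast
  qed (use open_F_abs_sublevel[OF assms(1,2)] in auto)
  have "F_abs (f x) \<le> real (Max M)" if x: "x \<in> K" for x
  proof -
    obtain m where "m \<in> M" "F_abs (f x) < real m"
      using M(2) x by blast
    moreover from this have "real m \<le> real (Max M)"
      using M(1) by simp
    ultimately show ?thesis by linarith
  qed
  with that show thesis .
qed

text \<open>One point \<open>y\<close> with value at least \<rho> replaces the norm on the ball.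
  Compactness makes that norm a genuine supremum, and since \<open>\<alpha> > 0\<close> passing to
  the smaller \<rho> only weakens the bound.\<close>

lemma good_fun_expball:
  fixes \<mu> :: "('q::{finite,field} fls ^ 'd::finite) measure"
  assumes "good_fun C \<alpha> U \<mu> f" "open U" "C > 0" "\<alpha> > 0"
    and "x \<in> msupp \<mu>" "expball x n \<subseteq> U" "y \<in> expball x n \<inter> msupp \<mu>" "\<rho> > 0" "\<rho> \<le> F_abs (f y)" "\<epsilon> > 0"
  shows "emeasure \<mu> {z \<in> expball x n. F_abs (f z) < \<epsilon>}
    \<le> ennreal (C * (\<epsilon> / \<rho>) powr \<alpha>) * emeasure \<mu> (expball x n)"
proof -
  define N where "N = norm_on \<mu> (expball x n) f"
  have cont: "continuous_on U f"
    using assms(1) by (simp add: good_fun_def)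
  obtain c where c: "\<And>z. z \<in> expball x n \<Longrightarrow> F_abs (f z) \<le> c"
    using compact_F_abs_bounded[OF cont assms(2) compact_expball assms(6)] by blast
  have "F_abs (f y) \<le> N"
    unfolding N_def norm_on_def
    by (rule cSUP_upper[OF assms(7)]) (use c in \<open>auto intro!: bdd_aboveI\<close>)
  then have N: "\<rho> \<le> N" "N > 0"
    using assms(8,9) by auto
  have "emeasure \<mu> {z \<in> expball x n. F_abs (f z) < \<epsilon>}
      \<le> ennreal (C * (\<epsilon> / N) powr \<alpha>) * emeasure \<mu> (expball x n)"
    using assms(1)[unfolded good_fun_def, THEN conjunct2, rule_format,
        of x "6 / 5 * exp (real_of_int n)" \<epsilon>] assms(5,6,10) N
    unfolding expball_eq_supball[symmetric] N_def by simp
  also have "\<dots> \<le> ennreal (C * (\<epsilon> / \<rho>) powr \<alpha>) * emeasure \<mu> (expball x n)"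
    using assms(3,4,8,10) N
    by (intro mult_right_mono ennreal_leI mult_left_mono powr_mono2 divide_left_mono) auto
  finally show ?thesis .
qed

text \<open>The small ball has positive measure because its centre is in the support, and finite
  measure by compactness; hence the quotient can be multiplied out.\<close>

lemma federer_on_expball:
  assumes "federer_on U \<mu>" "radon_measure \<mu>"
  obtains D :: real where "D > 0"
    and "\<And>x n. x \<in> msupp \<mu> \<Longrightarrow> expball x (n + 1) \<subseteq> U \<Longrightarrow> compact (expball x n) \<Longrightarrow>
       emeasure \<mu> (expball x (n + 1)) \<le> ennreal D * emeasure \<mu> (expball x n)"
proof -
  obtain D :: real where D: "D > 0" "\<And>x r. x \<in> msupp \<mu> \<Longrightarrow> r > 0 \<Longrightarrow> supball x (3 * r) \<subseteq> U \<Longrightarrow>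
      emeasure \<mu> (supball x (3 * r)) / emeasure \<mu> (supball x r) \<le> ennreal D"
    using assms(1) unfolding federer_on_def by blast
  have "emeasure \<mu> (expball x (n + 1)) \<le> ennreal D * emeasure \<mu> (expball x n)"
    if x: "x \<in> msupp \<mu>" "expball x (n + 1) \<subseteq> U" "compact (expball x n)" for x n
  proof -
    define a b where "a = emeasure \<mu> (expball x (n + 1))" and "b = emeasure \<mu> (expball x n)"
    have ab: "a / b \<le> ennreal D"
      using D(2)[OF x(1), of "6 / 5 * exp (real_of_int n)"] x(2)
      unfolding expball_eq_supball[symmetric] expball_Suc_eq_supball[symmetric] a_def b_def by simp
    have "b > 0"
      using x(1) expball_self open_expball unfolding msupp_def b_def by blast
    have "b < \<infinity>"
      using assms(2) x(3) unfolding radon_measure_def b_def by blast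
    then have "a / b * b = a"
      using \<open>b > 0\<close> by (simp add: ennreal_divide_times)
    moreover have "a / b * b \<le> ennreal D * b"
      using ab by (rule mult_right_mono) simp
    ultimately show ?thesis
      by (simp add: a_def b_def)
  qed
  with D(1) that show thesis by blast
qed

text \<open>The proof is Gaussian elimination on the functions.\<close>

lemma independent_coefficient_bound:
  fixes f :: "'r \<Rightarrow> 'x \<Rightarrow> 'a::field fls"
  assumes "finite I"
    and "\<And>c. (\<And>z. z \<in> Y \<Longrightarrow> (\<Sum>r\<in>I. c r * f r z) = 0) \<Longrightarrow> (\<forall>r\<in>I. c r = 0)"
  shows "\<exists>Z C. finite Z \<and> Z \<subseteq> Y \<and> C > 0 \<and>
    (\<forall>c m. m \<ge> 0 \<longrightarrow> (\<forall>z\<in>Z. F_abs (\<Sum>r\<in>I. c r * f r z) \<le> m) \<longrightarrow> (\<forall>r\<in>I. F_abs (c r) \<le> C * m))"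
  using assms
proof (induction I arbitrary: f rule: finite_induct)
  case empty
  show ?case
    by (intro exI[of _ "{}"] exI[of _ 1]) auto
next
  case (insert s I f)
  have "\<exists>y\<in>Y. f s y \<noteq> 0"
  proof (rule ccontr)
    assume "\<not> ?thesis"
    then have "(\<Sum>r\<in>insert s I. (if r = s then 1 else 0) * f r z) = 0" if "z \<in> Y" for z
      using insert(1) that by (intro sum.neutral) auto
    from insert.prems[OF this] show False by auto
  qed
  then obtain y where y: "y \<in> Y" "f s y \<noteq> 0" by blast
  \<comment> \<open>The pivot is the value of \<open>f s\<close> at \<open>y\<close>: each
    \<open>g r\<close> vanishes at \<open>y\<close>, which eliminates \<open>s\<close>.\<close>
  define q where "q r = f r y / f s y" for r
  define g where "g r z = f r z - q r * f s z" for r z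
  have g_sum: "(\<Sum>r\<in>I. c r * g r z) = (\<Sum>r\<in>I. c r * f r z) - (\<Sum>r\<in>I. c r * q r) * f s z" for c z
    by (simp add: g_def right_diff_distrib sum_subtractf sum_distrib_right mult.assoc)
  have g_indep: "\<forall>r\<in>I. c r = 0" if c: "\<And>z. z \<in> Y \<Longrightarrow> (\<Sum>r\<in>I. c r * g r z) = 0" for c
  proof -
    define c' where "c' = c(s := - (\<Sum>r\<in>I. c r * q r))"
    have "(\<Sum>r\<in>insert s I. c' r * f r z) = 0" if "z \<in> Y" for z
    proof -
      have "(\<Sum>r\<in>I. c' r * f r z) = (\<Sum>r\<in>I. c r * f r z)"
        using insert(2) by (intro sum.cong) (auto simp: c'_def)
      then have "(\<Sum>r\<in>insert s I. c' r * f r z) = (\<Sum>r\<in>I. c r * g r z)"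
        using insert(1,2) unfolding g_sum by (simp add: c'_def algebra_simps)
      with c[OF that] show ?thesis by simp
    qed
    from insert.prems[OF this] show ?thesis
      using insert(2) by (auto simp: c'_def split: if_splits)
  qed
  have "\<exists>Z C. finite Z \<and> Z \<subseteq> Y \<and> C > 0 \<and> (\<forall>c m. m \<ge> 0 \<longrightarrow>
      (\<forall>z\<in>Z. F_abs (\<Sum>r\<in>I. c r * g r z) \<le> m) \<longrightarrow> (\<forall>r\<in>I. F_abs (c r) \<le> C * m))"
    by (rule insert.IH) (rule g_indep)
  then obtain Z C where Z: "finite Z" "Z \<subseteq> Y" and C: "C > 0"
    and ZC: "\<forall>c m. m \<ge> 0 \<longrightarrow> (\<forall>z\<in>Z. F_abs (\<Sum>r\<in>I. c r * g r z) \<le> m) \<longrightarrow>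
      (\<forall>r\<in>I. F_abs (c r) \<le> C * m)"
    by (elim exE conjE)
  \<comment> \<open>\<open>K\<close> bounds the elimination multipliers on \<open>Z\<close>, and
    \<open>L\<close> those of the back substitution for \<open>c s\<close>. The summand 1 keeps both
    at least 1, so that they also absorb the terms that are not multiplied.\<close>
  define K where "K = 1 + (\<Sum>z\<in>Z. F_abs (f s z / f s y))"
  define L where "L = 1 + (\<Sum>r\<in>I. F_abs (q r))"
  define M where "M = 1 / F_abs (f s y)"
  have K1: "K \<ge> 1" and KZ: "\<And>z. z \<in> Z \<Longrightarrow> F_abs (f s z / f s y) \<le> K"
    using Z(1) by (auto simp: K_def intro!: sum_nonneg add_increasing member_le_sum)
  have L1: "L \<ge> 1" and LI: "\<And>r. r \<in> I \<Longrightarrow> F_abs (q r) \<le> L"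
    using insert(1) by (auto simp: L_def intro!: sum_nonneg add_increasing member_le_sum)
  have M0: "M > 0"
    using y by (simp add: M_def)
  show ?case
  proof (intro exI conjI allI impI ballI)
    show "finite (insert y Z)" "insert y Z \<subseteq> Y" "C * K * L + M > 0"
      using Z y C K1 L1 M0 by (auto intro!: add_pos_pos mult_pos_pos)
    fix c m r
    assume m: "(m::real) \<ge> 0" and r: "r \<in> insert s I"
      and h: "\<forall>z\<in>insert y Z. F_abs (\<Sum>r\<in>insert s I. c r * f r z) \<le> m"
    define h where "h z = (\<Sum>r\<in>insert s I. c r * f r z)" for z
    have h_le: "F_abs (h z) \<le> m" if "z \<in> insert y Z" for z
      unfolding h_def using h that by blast
    have h_eq: "h z = c s * f s z + (\<Sum>r\<in>I. c r * f r z)" for z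
      using insert(1,2) by (simp add: h_def)
    have cs: "c s = h y / f s y - (\<Sum>r\<in>I. c r * q r)"
      using y(2) unfolding h_eq q_def by (simp add: add_divide_distrib sum_divide_distrib)
    have gI: "(\<Sum>r\<in>I. c r * g r z) = h z - h y * (f s z / f s y)" for z
      unfolding g_sum using cs y(2) by (simp add: h_eq field_simps)
    have CI: "\<forall>r\<in>I. F_abs (c r) \<le> C * (K * m)"
    proof (rule ZC[THEN spec[of _ c], THEN spec[of _ "K * m"], THEN mp, THEN mp], goal_cases)
      case 1
      show ?case using K1 m by simp
    next
      case 2
      show ?case
      proof
      fix z assume z: "z \<in> Z"
      have "F_abs (h y * (f s z / f s y)) \<le> m * K"
        unfolding F_abs_mult using h_le[of y] KZ[OF z] m by (intro mult_mono) auto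
      moreover have "F_abs (h z) \<le> K * m"
        using h_le[of z] z mult_right_mono[OF K1 m] by simp
      ultimately show "F_abs (\<Sum>r\<in>I. c r * g r z) \<le> K * m"
        unfolding gI using F_abs_add_le[of "h z" "- (h y * (f s z / f s y))"] by (simp add: mult.commute)
      qed
    qed
    have CK: "0 \<le> C * K * m" and CKL: "C * K * m \<le> C * K * L * m"
      using C K1 L1 m mult_left_mono[OF L1, of "C * K * m"] by (simp_all add: mult_ac)
    have "0 \<le> M * m"
      using M0 m by simp
    show "F_abs (c r) \<le> (C * K * L + M) * m"
    proof (cases "r = s")
      case True
      have "F_abs (h y / f s y) \<le> M * m"
        using h_le[of y] y(2) by (simp add: F_abs_divide M_def divide_right_mono)
      moreover have "F_abs (\<Sum>r\<in>I. c r * q r) \<le> C * K * L * m"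
      proof (rule F_abs_sum_le)
        fix r assume "r \<in> I"
        then have "F_abs (c r * q r) \<le> (C * (K * m)) * L"
          unfolding F_abs_mult using CI LI C K1 m by (intro mult_mono) auto
        then show "F_abs (c r * q r) \<le> C * K * L * m"
          by (simp add: mult_ac)
      qed (use CK CKL in linarith)
      moreover note \<open>0 \<le> M * m\<close>
      moreover have "0 \<le> C * K * L * m"
        using CK CKL by linarith
      ultimately show ?thesis
        unfolding True using F_abs_add_le[of "h y / f s y" "- (\<Sum>r\<in>I. c r * q r)"]
        unfolding cs by (simp add: algebra_simps)
    next
      case False
      then have "F_abs (c r) \<le> C * K * m"
        using CI r by (simp add: mult.assoc)
      also have "\<dots> \<le> (C * K * L + M) * m"
        using CKL \<open>0 \<le> M * m\<close> unfolding distrib_right by linarith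
      finally show ?thesis .
    qed
  qed
qed

section \<open>Nondivergence for families of functions on an ultrametric space\<close>

text \<open>In the application \<open>S\<close> consists of subspaces, \<open>cmp\<close> is strict comparability and \<open>\<psi>\<close> is the
  covolume; \<open>F\<close> is then a flag all of whose members are short, but not too short, while everything
  that could refine it is long.\<close>

definition marked :: "('s \<Rightarrow> 's \<Rightarrow> bool) \<Rightarrow> ('s \<Rightarrow> 'x \<Rightarrow> real) \<Rightarrow> real \<Rightarrow> real \<Rightarrow> 's set \<Rightarrow> 'x \<Rightarrow> bool" where
  "marked cmp \<psi> \<epsilon> \<rho> S z \<longleftrightarrow> (\<exists>F\<subseteq>S.
     (\<forall>s\<in>F. \<epsilon> \<le> \<psi> s z \<and> \<psi> s z < \<rho>) \<and>
     (\<forall>s\<in>F. \<forall>s'\<in>F. s = s' \<or> cmp s s') \<and>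
     (\<forall>s\<in>S. (\<forall>s'\<in>F. cmp s s') \<longrightarrow> \<rho> \<le> \<psi> s z))"

text \<open>This is \<open>D + D^2 + ... + D^m\<close>. Each element put on the flag costs one more
  use of goodness and one passage to the next larger ball.\<close>

primrec nondiv_const :: "ennreal \<Rightarrow> nat \<Rightarrow> ennreal" where
  "nondiv_const D 0 = 0"
| "nondiv_const D (Suc m) = D * (nondiv_const D m + 1)"

lemma nondiv_const_less_top: "D < \<infinity> \<Longrightarrow> nondiv_const D m < \<infinity>"
  by (induction m) (simp_all add: ennreal_mult_less_top)

text \<open>\<open>S\<close> may be infinite as long as \<open>rk\<close> takes finitely many
  values. The hypothesis \<open>good\<close> speaks of a measurable hull \<open>A\<close> because
  the sublevel sets of \<open>\<psi> s\<close> are not assumed measurable.\<close>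

locale nondivergence =
  fixes M :: "'x measure" and uball :: "'x \<Rightarrow> int \<Rightarrow> 'x set" and X B0 :: "'x set"
    and S :: "'s set" and rk :: "'s \<Rightarrow> nat" and cmp :: "'s \<Rightarrow> 's \<Rightarrow> bool"
    and \<psi> :: "'s \<Rightarrow> 'x \<Rightarrow> real" and \<epsilon> \<rho> :: real and c D :: ennreal
  assumes uball_self: "x \<in> uball x n"
    and uball_eq: "y \<in> uball x n \<Longrightarrow> uball y n = uball x n"
    and uball_Suc: "uball x n \<subseteq> uball x (n + 1)"
    and uball_sets: "uball x n \<in> sets M"
    and uball_countable: "countable {uball y l |y. y \<in> B0}"
    and doubling: "\<And>x n. x \<in> X \<Longrightarrow> uball x (n + 1) \<subseteq> B0 \<Longrightarrow>
        emeasure M (uball x (n + 1)) \<le> D * emeasure M (uball x n)"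
    and cmp_sym: "\<And>s s'. cmp s s' \<Longrightarrow> cmp s' s"
    and cmp_rk: "\<And>s s'. s \<in> S \<Longrightarrow> s' \<in> S \<Longrightarrow> cmp s s' \<Longrightarrow> rk s \<noteq> rk s'"
    and finite_rk: "finite (rk ` S)"
    and good: "\<And>s x n y. s \<in> S \<Longrightarrow> x \<in> X \<Longrightarrow> uball x n \<subseteq> B0 \<Longrightarrow> y \<in> uball x n \<inter> X \<Longrightarrow> \<rho> \<le> \<psi> s y \<Longrightarrow>
        \<exists>A\<in>sets M. {z \<in> uball x n \<inter> X. \<psi> s z < \<epsilon>} \<subseteq> A \<and> emeasure M A \<le> c * emeasure M (uball x n)"
    and usc: "\<And>s x. s \<in> S \<Longrightarrow> x \<in> X \<inter> B0 \<Longrightarrow> \<psi> s x < \<rho> \<Longrightarrow> \<exists>n. \<forall>y\<in>uball x n. \<psi> s y < \<rho>"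
begin

lemma uball_mono: "n \<le> m \<Longrightarrow> uball x n \<subseteq> uball x m"
proof (induction m rule: int_ge_induct)
  case (step i)
  then show ?case using uball_Suc[of x i] by blast
qed simp

text \<open>The induction removes one element from the flag at a time: around every unmarked point one
  takes the largest ball on which some \<open>\<psi> s\<close> stays below \<open>\<rho>\<close>. On the next larger ball all
  \<open>\<psi> s'\<close> reach \<open>\<rho>\<close>, so the induction hypothesis applies there to the elements comparable to \<open>s\<close>.\<close>

lemma unmarked_le:
  assumes "S' \<subseteq> S" "card (rk ` S') \<le> m" "x \<in> X" "uball x n \<subseteq> B0"
    and "\<And>s. s \<in> S' \<Longrightarrow> \<exists>y\<in>uball x n \<inter> X. \<rho> \<le> \<psi> s y"
  shows "\<exists>A\<in>sets M. {y \<in> uball x n \<inter> X. \<not> marked cmp \<psi> \<epsilon> \<rho> S' y} \<subseteq> A \<and>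
    emeasure M A \<le> nondiv_const D m * c * emeasure M (uball x n)"
  using assms
proof (induction m arbitrary: S' x n)
  case 0
  have "finite (rk ` S')"
    using 0(1) finite_rk by (meson finite_subset image_mono)
  with 0(2) have "S' = {}"
    by simp
  then have "marked cmp \<psi> \<epsilon> \<rho> S' y" for y
    by (auto simp: marked_def)
  then show ?case
    by (intro bexI[of _ "{}"]) auto
next
  case (Suc m)
  define Y where "Y = {y \<in> uball x n \<inter> X. \<not> marked cmp \<psi> \<epsilon> \<rho> S' y}"
  \<comment> \<open>The levels are integers below \<open>n\<close>, so a nonempty \<open>L y\<close>
    has a greatest element even when infinitely many \<open>s\<close> contribute to it.\<close>
  define L where "L y = {l. l < n \<and> (\<exists>s\<in>S'. \<forall>z\<in>uball y l \<inter> X. \<psi> s z < \<rho>)}" for y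
  define lv where "lv y = (GREATEST l. l \<in> L y)" for y
  have Y_B0: "y \<in> X \<inter> B0" "y \<in> uball x n" "uball y n = uball x n" "y \<in> X" if "y \<in> Y" for y
    using that Suc.prems(4) uball_eq[of y x n] unfolding Y_def by auto
  have L: "lv y \<in> L y" "\<And>l. l \<in> L y \<Longrightarrow> l \<le> lv y" if y: "y \<in> Y" for y
  proof -
    \<comment> \<open>Otherwise the empty flag would mark \<open>y\<close>.\<close>
    have "\<not> (\<forall>s\<in>S'. \<rho> \<le> \<psi> s y)"
      using y unfolding Y_def marked_def by blast
    then obtain s where s: "s \<in> S'" "\<psi> s y < \<rho>"
      by force
    then obtain l where l: "\<forall>z\<in>uball y l. \<psi> s z < \<rho>"
      using usc[of s y] Suc.prems(1) Y_B0[OF y] by blast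
    have "min l (n - 1) \<in> L y"
      unfolding L_def using s(1) l uball_mono[of "min l (n - 1)" l y] by auto
    then have ex: "\<exists>i. (n - int i) \<in> L y"
      by (intro exI[of _ "nat (n - min l (n - 1))"]) auto
    define i where "i = (LEAST i. n - int i \<in> L y)"
    have i: "n - int i \<in> L y"
      unfolding i_def using ex by (rule LeastI_ex)
    have "l \<le> n - int i" if "l \<in> L y" for l
    proof -
      have "n - int (nat (n - l)) = l"
        using that by (simp add: L_def)
      then have "i \<le> nat (n - l)"
        unfolding i_def using that by (intro Least_le) simp
      moreover have "l < n"
        using that by (simp add: L_def)
      ultimately show ?thesis
        by linarith
    qed
    note i this
    moreover from this have "lv y = n - int i"
      unfolding lv_def by (intro Greatest_equality) auto
    ultimately show "lv y \<in> L y" "\<And>l. l \<in> L y \<Longrightarrow> l \<le> lv y"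
      by auto
  qed
  have Cov: "\<exists>A\<in>sets M. A \<subseteq> uball y (lv y) \<and> Y \<inter> uball y (lv y) \<subseteq> A \<and>
      emeasure M A \<le> nondiv_const D (Suc m) * c * emeasure M (uball y (lv y))" if y: "y \<in> Y" for y
  proof -
    define l where "l = lv y"
    have l: "l < n"
      using L(1)[OF y] by (simp add: L_def l_def)
    obtain s where s: "s \<in> S'" "\<And>z. z \<in> uball y l \<inter> X \<Longrightarrow> \<psi> s z < \<rho>"
      using L(1)[OF y] unfolding L_def l_def by blast
    have parent: "uball y (l + 1) \<subseteq> B0" "uball y (l + 1) \<subseteq> uball x n"
      using l uball_mono[of "l + 1" n y] Y_B0[OF y] Suc.prems(4) by auto
    \<comment> \<open>Maximality of \<open>l\<close> speaks only of levels below \<open>n\<close>.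
      At \<open>l + 1 = n\<close> the ball is the starting ball, and the assumption of the lemma
      takes over.\<close>
    have large: "\<exists>z\<in>uball y (l + 1) \<inter> X. \<rho> \<le> \<psi> s' z" if "s' \<in> S'" for s'
    proof (cases "l + 1 = n")
      case True
      with Suc.prems(5)[OF that] Y_B0[OF y] show ?thesis by simp
    next
      case False
      then have "l + 1 \<notin> L y"
        using L(2)[OF y, of "l + 1"] by (auto simp: l_def)
      with False l that show ?thesis
        unfolding L_def by force
    qed
    \<comment> \<open>The induction counts values of \<open>rk\<close>, not elements: comparable
      elements differ in rank, so passing to \<open>S''\<close> loses at least the value
      \<open>rk s\<close>.\<close>
    define S'' where "S'' = {s' \<in> S'. cmp s' s}"
    have fin: "finite (rk ` S')"
      using Suc.prems(1) finite_rk by (meson finite_subset image_mono)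
    have "rk ` S'' \<subseteq> rk ` S' - {rk s}"
    proof
      fix i assume "i \<in> rk ` S''"
      then obtain s' where "s' \<in> S'" "cmp s' s" "i = rk s'"
        by (auto simp: S''_def)
      then show "i \<in> rk ` S' - {rk s}"
        using cmp_rk[of s' s] Suc.prems(1) s(1) by auto
    qed
    then have "card (rk ` S'') \<le> card (rk ` S' - {rk s})"
      using fin by (intro card_mono) auto
    also have "\<dots> \<le> m"
      using fin s(1) Suc.prems(2) by (simp add: card_Diff_singleton)
    finally have card: "card (rk ` S'') \<le> m" .
    have S'': "S'' \<subseteq> S" "S'' \<subseteq> S'"
      using Suc.prems(1) by (auto simp: S''_def)
    obtain A1 where A1: "A1 \<in> sets M" "{z \<in> uball y (l + 1) \<inter> X. \<not> marked cmp \<psi> \<epsilon> \<rho> S'' z} \<subseteq> A1"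
        "emeasure M A1 \<le> nondiv_const D m * c * emeasure M (uball y (l + 1))"
    proof -
      have "\<exists>A\<in>sets M. {z \<in> uball y (l + 1) \<inter> X. \<not> marked cmp \<psi> \<epsilon> \<rho> S'' z} \<subseteq> A \<and>
          emeasure M A \<le> nondiv_const D m * c * emeasure M (uball y (l + 1))"
        using S''(2) by (intro Suc.IH[OF S''(1) card Y_B0(4)[OF y] parent(1)] large) auto
      then show thesis
        by (elim bexE conjE) (rule that)
    qed
    obtain w where w: "w \<in> uball y (l + 1) \<inter> X" "\<rho> \<le> \<psi> s w"
      using large[OF s(1)] by blast
    obtain A2 where A2: "A2 \<in> sets M" "{z \<in> uball y (l + 1) \<inter> X. \<psi> s z < \<epsilon>} \<subseteq> A2"
        "emeasure M A2 \<le> c * emeasure M (uball y (l + 1))"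
      using good[OF _ Y_B0(4)[OF y] parent(1) w] s(1) Suc.prems(1) by blast
    show ?thesis
      unfolding l_def[symmetric]
    proof (intro bexI conjI)
      show "(A1 \<union> A2) \<inter> uball y l \<in> sets M"
        using A1 A2 uball_sets by auto
      show "Y \<inter> uball y l \<subseteq> (A1 \<union> A2) \<inter> uball y l"
      proof
        fix z assume z: "z \<in> Y \<inter> uball y l"
        then have zX: "z \<in> uball y (l + 1) \<inter> X" "z \<in> uball y l \<inter> X"
          using uball_Suc[of y l] by (auto simp: Y_def)
        have "z \<in> A1 \<union> A2"
        proof (rule ccontr)
          assume nz: "z \<notin> A1 \<union> A2"
          then have "marked cmp \<psi> \<epsilon> \<rho> S'' z"
            using A1(2) zX by auto
          then obtain F where F: "F \<subseteq> S''" "\<forall>s\<in>F. \<epsilon> \<le> \<psi> s z \<and> \<psi> s z < \<rho>"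
              "\<forall>s\<in>F. \<forall>s'\<in>F. s = s' \<or> cmp s s'"
              "\<forall>s\<in>S''. (\<forall>s'\<in>F. cmp s s') \<longrightarrow> \<rho> \<le> \<psi> s z"
            unfolding marked_def by (elim exE conjE)
          have "\<epsilon> \<le> \<psi> s z"
            using A2(2) nz zX by force
          moreover have Fs: "cmp s' s" "cmp s s'" if "s' \<in> F" for s'
            using F(1) that cmp_sym unfolding S''_def by auto
          \<comment> \<open>Adjoining \<open>s\<close> preserves maximality of the flag: whatever is
            comparable to all of \<open>insert s F\<close> is comparable to \<open>s\<close>, hence
            lies in \<open>S''\<close>, where \<open>F\<close> was already maximal.\<close>
          ultimately have "marked cmp \<psi> \<epsilon> \<rho> S' z"
            unfolding marked_def
          proof (intro exI[of _ "insert s F"] conjI ballI impI)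
            show "insert s F \<subseteq> S'"
              using s(1) F(1) S''(2) by auto
          next
            fix s' assume "s' \<in> S'" "\<forall>s''\<in>insert s F. cmp s' s''"
            then show "\<rho> \<le> \<psi> s' z"
              by (intro F(4)[rule_format]) (auto simp: S''_def)
          qed (use F s zX in auto)
          with z show False
            by (simp add: Y_def)
        qed
        with z show "z \<in> (A1 \<union> A2) \<inter> uball y l" by blast
      qed
      \<comment> \<open>Both hulls are estimated on the parent ball, where the functions are known
        to be large; \<open>doubling\<close> brings the bound back to the ball of level
        \<open>l\<close>.\<close>
      have "emeasure M ((A1 \<union> A2) \<inter> uball y l) \<le> emeasure M (A1 \<union> A2)"
        using A1 A2 by (intro emeasure_mono) auto
      also have "\<dots> \<le> emeasure M A1 + emeasure M A2"
        using A1 A2 by (intro emeasure_subadditive) auto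
      also have "\<dots> \<le> nondiv_const D m * c * emeasure M (uball y (l + 1)) + c * emeasure M (uball y (l + 1))"
        using A1 A2 by (intro add_mono) auto
      also have "\<dots> = (nondiv_const D m + 1) * c * emeasure M (uball y (l + 1))"
        by (simp add: distrib_right)
      also have "\<dots> \<le> (nondiv_const D m + 1) * c * (D * emeasure M (uball y l))"
        using doubling[OF Y_B0(4)[OF y] parent(1)] by (intro mult_left_mono) auto
      also have "\<dots> = nondiv_const D (Suc m) * c * emeasure M (uball y l)"
        by (simp add: mult_ac)
      finally show "emeasure M ((A1 \<union> A2) \<inter> uball y l) \<le> nondiv_const D (Suc m) * c * emeasure M (uball y l)" .
    qed auto
  qed
  \<comment> \<open>Indexing by balls instead of points makes the family countable and disjoint, and
    \<open>A b \<subseteq> b\<close> carries the disjointness over to the hulls.\<close>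
  define BB where "BB = (\<lambda>y. uball y (lv y)) ` Y"
  have "\<exists>A. \<forall>b\<in>BB. A b \<in> sets M \<and> A b \<subseteq> b \<and> Y \<inter> b \<subseteq> A b \<and>
      emeasure M (A b) \<le> nondiv_const D (Suc m) * c * emeasure M b"
  proof (intro bchoice ballI)
    fix b assume "b \<in> BB"
    then obtain y where "y \<in> Y" "b = uball y (lv y)"
      by (auto simp: BB_def)
    then show "\<exists>A. A \<in> sets M \<and> A \<subseteq> b \<and> Y \<inter> b \<subseteq> A \<and>
        emeasure M A \<le> nondiv_const D (Suc m) * c * emeasure M b"
      using Cov[of y] by (simp only: Bex_def)
  qed
  then obtain A where A: "\<And>b. b \<in> BB \<Longrightarrow> A b \<in> sets M" "\<And>b. b \<in> BB \<Longrightarrow> A b \<subseteq> b"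
      "\<And>b. b \<in> BB \<Longrightarrow> Y \<inter> b \<subseteq> A b"
      "\<And>b. b \<in> BB \<Longrightarrow> emeasure M (A b) \<le> nondiv_const D (Suc m) * c * emeasure M b"
    by metis
  have "BB \<subseteq> (\<Union>l. {uball y l |y. y \<in> B0})"
    using Y_B0 by (auto simp: BB_def)
  then have BB_count: "countable BB"
    by (rule countable_subset) (intro countable_UN uball_countable countableI_type)
  \<comment> \<open>If two chosen balls meet, the one of higher level is also a ball around the
    other centre, so its level is admissible there and maximality forces equal levels.\<close>
  have lv_le: "lv y \<le> lv y'" if "y \<in> Y" "y' \<in> Y" "z \<in> uball y (lv y)" "z \<in> uball y' (lv y')" "lv y' \<le> lv y" for y y' z
  proof -
    have "z \<in> uball y' (lv y)"
      using that uball_mono by blast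
    then have "uball y (lv y) = uball y' (lv y)"
      using uball_eq that(3) by blast
    then have "lv y \<in> L y'"
      using L(1)[OF that(1)] unfolding L_def by simp
    then show ?thesis
      using L(2)[OF that(2)] by blast
  qed
  have same: "uball y (lv y) = uball y' (lv y')"
    if "y \<in> Y" "y' \<in> Y" "z \<in> uball y (lv y)" "z \<in> uball y' (lv y')" for y y' z
  proof -
    have "lv y = lv y'"
      using lv_le[OF that] lv_le[OF that(2,1,4,3)] by linarith
    then show ?thesis
      using that uball_eq by metis
  qed
  have disj: "disjoint_family_on (\<lambda>b. b) BB"
    unfolding disjoint_family_on_def BB_def using same by blast
  have disjA: "disjoint_family_on A BB"
    using disj A(2) unfolding disjoint_family_on_def by blast
  have BB_sets: "b \<in> sets M" if "b \<in> BB" for b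
    using that uball_sets by (auto simp: BB_def)
  show ?case
  proof (intro bexI[of _ "\<Union>b\<in>BB. A b"] conjI)
    show "(\<Union>b\<in>BB. A b) \<in> sets M"
      using BB_count A(1) by (intro sets.countable_UN') auto
    have "Y \<subseteq> (\<Union>b\<in>BB. A b)"
    proof
      fix y assume "y \<in> Y"
      then have "uball y (lv y) \<in> BB" "y \<in> Y \<inter> uball y (lv y)"
        using uball_self by (auto simp: BB_def)
      then show "y \<in> (\<Union>b\<in>BB. A b)"
        using A(3) by blast
    qed
    then show "{y \<in> uball x n \<inter> X. \<not> marked cmp \<psi> \<epsilon> \<rho> S' y} \<subseteq> (\<Union>b\<in>BB. A b)"
      by (simp add: Y_def)
    have "emeasure M (\<Union>b\<in>BB. A b) = (\<integral>\<^sup>+b. emeasure M (A b) \<partial>count_space BB)"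
      using A(1) BB_count disjA by (intro emeasure_UN_countable) auto
    also have "\<dots> \<le> (\<integral>\<^sup>+b. nondiv_const D (Suc m) * c * emeasure M b \<partial>count_space BB)"
      using A(4) by (intro nn_integral_mono) simp
    also have "\<dots> = nondiv_const D (Suc m) * c * (\<integral>\<^sup>+b. emeasure M b \<partial>count_space BB)"
      by (intro nn_integral_cmult) simp
    also have "(\<integral>\<^sup>+b. emeasure M b \<partial>count_space BB) = emeasure M (\<Union>b\<in>BB. b)"
      using BB_sets BB_count disj by (intro emeasure_UN_countable[symmetric]) auto
    also have "\<dots> \<le> emeasure M (uball x n)"
    proof (intro emeasure_mono uball_sets UN_least)
      fix b assume "b \<in> BB"
      then obtain y where y: "y \<in> Y" "b = uball y (lv y)"
        by (auto simp: BB_def)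
      moreover have "lv y < n"
        using L(1)[OF y(1)] by (simp add: L_def)
      ultimately show "b \<subseteq> uball x n"
        using uball_mono[of "lv y" n y] Y_B0[OF y(1)] by simp
    qed
    finally show "emeasure M (\<Union>b\<in>BB. A b) \<le> nondiv_const D (Suc m) * c * emeasure M (uball x n)"
      by (simp add: mult_left_mono)
  qed
qed

end

section \<open>Minors and integral bases\<close>

text \<open>Rows are coordinates and columns are vectors. Since \<open>\<sigma>\<close> is any
  selection of rows, a row is replaced by a function update, and a repeated row simply gives
  0.\<close>

definition minor :: "nat \<Rightarrow> (nat \<Rightarrow> 'i \<Rightarrow> 'a::comm_ring_1) \<Rightarrow> (nat \<Rightarrow> 'i) \<Rightarrow> 'a" where
  "minor j b \<sigma> = det (mat j j (\<lambda>(i, l). b l (\<sigma> i)))"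

lemma minor_cong:
  assumes "\<And>i l. i < j \<Longrightarrow> l < j \<Longrightarrow> b l (\<sigma> i) = b' l (\<sigma>' i)"
  shows "minor j b \<sigma> = minor j b' \<sigma>'"
  unfolding minor_def using assms by (intro arg_cong[of _ _ det] eq_matI) auto

lemma minor_0 [simp]: "minor 0 b \<sigma> = 1"
  unfolding minor_def by (rule det_dim_zero) auto

lemma minor_expand_column_0:
  "minor (Suc j) b \<sigma> = (\<Sum>i<Suc j. b 0 (\<sigma> i) * ((-1) ^ i *
     minor j (\<lambda>l. b (Suc l)) (\<lambda>i'. \<sigma> (if i' < i then i' else Suc i'))))"
proof -
  let ?A = "mat (Suc j) (Suc j) (\<lambda>(i, l). b l (\<sigma> i))"
  have "minor (Suc j) b \<sigma> = (\<Sum>i<Suc j. ?A $$ (i, 0) * cofactor ?A i 0)"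
    unfolding minor_def by (rule laplace_expansion_column) auto
  also have "\<dots> = (\<Sum>i<Suc j. b 0 (\<sigma> i) * ((-1) ^ i *
     minor j (\<lambda>l. b (Suc l)) (\<lambda>i'. \<sigma> (if i' < i then i' else Suc i'))))"
  proof (intro sum.cong refl)
    fix i assume i: "i \<in> {..<Suc j}"
    have "mat_delete ?A i 0 = mat j j (\<lambda>(i', l). b (Suc l) (\<sigma> (if i' < i then i' else Suc i')))"
      unfolding mat_delete_def by (intro eq_matI) auto
    then show "?A $$ (i, 0) * cofactor ?A i 0 = b 0 (\<sigma> i) * ((-1) ^ i *
       minor j (\<lambda>l. b (Suc l)) (\<lambda>i'. \<sigma> (if i' < i then i' else Suc i')))"
      using i by (simp add: cofactor_def minor_def)
  qed
  finally show ?thesis .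
qed

text \<open>The cofactors along row \<open>i\<close> do not see that row, so the minor is a fixed
  linear functional of it. The second clause identifies the coefficient that must be nonzero in
  Cramer's rule.\<close>

lemma minor_expand_row:
  assumes "i < j"
  obtains c where "\<And>r. minor j b (\<sigma>(i := r)) = (\<Sum>l<j. b l r * c l)"
    and "\<And>k. j = Suc k \<Longrightarrow> i = 0 \<Longrightarrow> c 0 = minor k (\<lambda>l. b (Suc l)) (\<lambda>i'. \<sigma> (Suc i'))"
proof -
  define A where "A = (\<lambda>r. mat j j (\<lambda>(i', l). b l ((\<sigma>(i := r)) i')))"
  have cof: "cofactor (A r) i l = cofactor (A (\<sigma> i)) i l" if "l < j" for r l
  proof -
    have "mat_delete (A r) i l = mat_delete (A (\<sigma> i)) i l"
      unfolding mat_delete_def A_def by (intro eq_matI) (use that in auto)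
    then show ?thesis
      by (simp add: cofactor_def)
  qed
  have "minor j b (\<sigma>(i := r)) = (\<Sum>l<j. b l r * cofactor (A (\<sigma> i)) i l)" for r
  proof -
    have "det (A r) = (\<Sum>l<j. A r $$ (i, l) * cofactor (A r) i l)"
      using assms by (intro laplace_expansion_row) (auto simp: A_def)
    also have "\<dots> = (\<Sum>l<j. b l r * cofactor (A (\<sigma> i)) i l)"
    proof (intro sum.cong refl)
      fix l assume "l \<in> {..<j}"
      then show "A r $$ (i, l) * cofactor (A r) i l = b l r * cofactor (A (\<sigma> i)) i l"
        using assms by (subst cof) (simp_all add: A_def)
    qed
    finally show ?thesis
      by (simp add: minor_def A_def)
  qed
  moreover have "cofactor (A (\<sigma> i)) i 0 = minor k (\<lambda>l. b (Suc l)) (\<lambda>i'. \<sigma> (Suc i'))"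
    if "j = Suc k" "i = 0" for k
  proof -
    have "mat_delete (A (\<sigma> i)) i 0 = mat k k (\<lambda>(i, l). b (Suc l) (\<sigma> (Suc i)))"
      unfolding mat_delete_def A_def using that by (intro eq_matI) auto
    then show ?thesis
      using that by (simp add: cofactor_def minor_def)
  qed
  ultimately show thesis
    using that by blast
qed

lemma minor_row_linear:
  assumes "i < j" and "\<And>l. l < j \<Longrightarrow> b l x = (\<Sum>r\<in>I. f r * b l (g r))"
  shows "minor j b (\<sigma>(i := x)) = (\<Sum>r\<in>I. f r * minor j b (\<sigma>(i := g r)))"
proof -
  obtain c where c: "\<And>r. minor j b (\<sigma>(i := r)) = (\<Sum>l<j. b l r * c l)"
    using minor_expand_row[OF assms(1)] by metis
  have "minor j b (\<sigma>(i := x)) = (\<Sum>l<j. (\<Sum>r\<in>I. f r * b l (g r)) * c l)"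
    unfolding c using assms(2) by simp
  also have "\<dots> = (\<Sum>r\<in>I. \<Sum>l<j. f r * (b l (g r) * c l))"
    by (subst sum.swap) (simp add: sum_distrib_right mult.assoc)
  finally show ?thesis
    unfolding c by (simp add: sum_distrib_left)
qed

lemma minor_mult:
  assumes "\<And>i l. i < j \<Longrightarrow> l < j \<Longrightarrow> b' l (\<sigma> i) = (\<Sum>k<j. b k (\<sigma> i) * m k l)"
  shows "minor j b' \<sigma> = minor j b \<sigma> * det (mat j j (\<lambda>(k, l). m k l))"
proof -
  have "mat j j (\<lambda>(i, l). b' l (\<sigma> i)) = mat j j (\<lambda>(i, l). b l (\<sigma> i)) * mat j j (\<lambda>(k, l). m k l)"
    using assms by (intro eq_matI) (auto simp: scalar_prod_def atLeast0LessThan)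
  then show ?thesis
    unfolding minor_def by (simp add: det_mult[of _ j])
qed

lemma minor_zero_column:
  assumes "l < j" "\<And>i. i < j \<Longrightarrow> b l (\<sigma> i) = 0"
  shows "minor j b \<sigma> = 0"
  unfolding minor_def
  by (subst laplace_expansion_column[of _ j l]) (use assms in auto)

lemma minor_identical_rows:
  assumes "i < j" "i' < j" "i \<noteq> i'" "\<sigma> i = \<sigma> i'"
  shows "minor j b \<sigma> = 0"
  unfolding minor_def
  by (rule det_identical_rows[of _ j i i']) (use assms in \<open>auto intro!: eq_vecI\<close>)

lemma minor_scale: "minor j (\<lambda>l r. c * b l r) \<sigma> = c ^ j * minor j b \<sigma>"
proof -
  have "mat j j (\<lambda>(i, l). c * b l (\<sigma> i)) = c \<cdot>\<^sub>m mat j j (\<lambda>(i, l). b l (\<sigma> i))"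
    by (intro eq_matI) auto
  then show ?thesis
    by (simp add: minor_def)
qed

lemma minor_in_range_of_Lambda:
  assumes "\<And>i l. i < j \<Longrightarrow> l < j \<Longrightarrow> b l (\<sigma> i) \<in> range of_Lambda"
  shows "minor j b \<sigma> \<in> range of_Lambda"
proof -
  have "minor j b \<sigma> = (\<Sum>p | p permutes {0..<j}. signof p * (\<Prod>i=0..<j. b (p i) (\<sigma> i)))"
    unfolding minor_def det_def
    by (auto intro!: sum.cong prod.cong arg_cong[of _ _ "\<lambda>x. _ * x"])
  also have "\<dots> \<in> range of_Lambda"
  proof (intro range_of_Lambda_sum range_of_Lambda_mult range_of_Lambda_prod)
    fix p :: "nat \<Rightarrow> nat"
    show "signof p \<in> range of_Lambda"
      unfolding sign_def by (auto intro: range_of_Lambda_1 range_of_Lambda_uminus)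
  next
    fix p i assume "p \<in> {p. p permutes {0..<j}}" "i \<in> {0..<j}"
    then show "b (p i) (\<sigma> i) \<in> range of_Lambda"
      using permutes_in_image[of p "{0..<j}" i] assms by simp
  qed
  finally show ?thesis .
qed

section \<open>Spans and independent families of integral vectors\<close>

definition lin_span :: "nat \<Rightarrow> (nat \<Rightarrow> 'i \<Rightarrow> 'a::field) \<Rightarrow> ('i \<Rightarrow> 'a) set" where
  "lin_span j b = {v. \<exists>c. \<forall>r. v r = (\<Sum>l<j. c l * b l r)}"

definition int_vec :: "'i set \<Rightarrow> ('i \<Rightarrow> 'a::field fls) \<Rightarrow> bool" where
  "int_vec I v \<longleftrightarrow> (\<forall>r. v r \<in> range of_Lambda) \<and> (\<forall>r. r \<notin> I \<longrightarrow> v r = 0)"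

text \<open>Independence is witnessed by a nonvanishing minor, because it is the size of minors that
  is estimated later.\<close>

definition frame :: "'i set \<Rightarrow> nat \<Rightarrow> (nat \<Rightarrow> 'i \<Rightarrow> 'a::field fls) \<Rightarrow> bool" where
  "frame I j b \<longleftrightarrow> (\<forall>l<j. int_vec I (b l)) \<and> (\<exists>\<sigma>. (\<forall>i<j. \<sigma> i \<in> I) \<and> minor j b \<sigma> \<noteq> 0)"

lemma lin_span_base:
  assumes "l < j"
  shows "b l \<in> lin_span j b"
  unfolding lin_span_def
proof (intro CollectI exI allI)
  fix r
  show "b l r = (\<Sum>k<j. (if k = l then 1 else 0) * b k r)"
    using assms by (simp add: if_distrib[of "\<lambda>x. x * _"] cong: if_cong)
qed

lemma lin_span_coefficients:
  assumes "\<And>l. l < j' \<Longrightarrow> b' l \<in> lin_span j b"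
  obtains m where "\<And>l r. l < j' \<Longrightarrow> b' l r = (\<Sum>k<j. b k r * m k l)"
proof -
  have "\<forall>l\<in>{..<j'}. \<exists>c. \<forall>r. b' l r = (\<Sum>k<j. c k * b k r)"
    using assms by (simp add: lin_span_def)
  from bchoice[OF this] obtain c where "\<forall>l\<in>{..<j'}. \<forall>r. b' l r = (\<Sum>k<j. c l k * b k r)" ..
  then show thesis
    by (intro that[of "\<lambda>k l. c l k"]) (simp add: mult.commute)
qed

lemma lin_span_subset:
  assumes "\<And>l. l < j' \<Longrightarrow> b' l \<in> lin_span j b"
  shows "lin_span j' b' \<subseteq> lin_span j b"
proof
  fix v assume "v \<in> lin_span j' b'"
  then obtain c where c: "\<And>r. v r = (\<Sum>l<j'. c l * b' l r)"
    by (auto simp: lin_span_def)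
  obtain m where m: "\<And>l r. l < j' \<Longrightarrow> b' l r = (\<Sum>k<j. b k r * m k l)"
    by (rule lin_span_coefficients[of j' b' j b]) (use assms in auto)
  have "v r = (\<Sum>k<j. (\<Sum>l<j'. c l * m k l) * b k r)" for r
  proof -
    have "v r = (\<Sum>l<j'. \<Sum>k<j. c l * m k l * b k r)"
      unfolding c by (intro sum.cong refl) (simp add: m sum_distrib_left mult_ac)
    also have "\<dots> = (\<Sum>k<j. (\<Sum>l<j'. c l * m k l) * b k r)"
      by (subst sum.swap) (simp add: sum_distrib_right)
    finally show ?thesis .
  qed
  then show "v \<in> lin_span j b"
    unfolding lin_span_def by (intro CollectI exI allI)
qed

text \<open>Cramer's rule: if all minors of size \<open>j + 1\<close> vanish, expanding them along a variable row
  exhibits \<open>v\<close> as a linear combination.\<close>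

lemma frame_extend:
  assumes b: "frame I j b" and v: "int_vec I v" "v \<notin> lin_span j b"
  shows "frame I (Suc j) (case_nat v b)"
proof -
  obtain \<sigma> where \<sigma>: "\<And>i. i < j \<Longrightarrow> \<sigma> i \<in> I" "minor j b \<sigma> \<noteq> 0"
    using b by (auto simp: frame_def)
  define B where "B = case_nat v b"
  define \<tau> where "\<tau> = case_nat undefined \<sigma>"
  obtain c where c: "\<And>r. minor (Suc j) B (\<tau>(0 := r)) = (\<Sum>l<Suc j. B l r * c l)"
    and c0: "\<And>k. Suc j = Suc k \<Longrightarrow> c 0 = minor k (\<lambda>l. B (Suc l)) (\<lambda>i. \<tau> (Suc i))"
    using minor_expand_row[of 0 "Suc j" B \<tau>] by (metis zero_less_Suc)
  have c0': "c 0 \<noteq> 0"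
    using c0[of j] \<sigma>(2) by (simp add: B_def \<tau>_def)
  have "\<exists>r\<in>I. minor (Suc j) B (\<tau>(0 := r)) \<noteq> 0"
  proof (rule ccontr)
    assume *: "\<not> ?thesis"
    have "v r = (\<Sum>l<j. (- c (Suc l) / c 0) * b l r)" for r
    proof (cases "r \<in> I")
      case True
      then have "0 = v r * c 0 + (\<Sum>l<j. b l r * c (Suc l))"
        using * c[of r] by (simp add: sum.lessThan_Suc_shift B_def del: sum.lessThan_Suc)
      then have "v r = - (\<Sum>l<j. b l r * c (Suc l)) / c 0"
        using c0' by (simp add: field_simps eq_neg_iff_add_eq_0)
      then show ?thesis
        by (simp add: sum_negf[symmetric] sum_divide_distrib mult.commute)
    next
      case False
      then have "b l r = 0" if "l < j" for l
        using b that by (auto simp: frame_def int_vec_def)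
      then show ?thesis
        using False v(1) by (simp add: int_vec_def)
    qed
    then have "v \<in> lin_span j b"
      unfolding lin_span_def by (intro CollectI exI allI)
    with v(2) show False ..
  qed
  then obtain r where "r \<in> I" "minor (Suc j) B (\<tau>(0 := r)) \<noteq> 0" ..
  moreover from this have "\<forall>i<Suc j. (\<tau>(0 := r)) i \<in> I"
    using \<sigma>(1) by (auto simp: \<tau>_def split: nat.split)
  moreover have "int_vec I (B l)" if "l < Suc j" for l
    using that v(1) b by (cases l) (auto simp: B_def frame_def)
  ultimately show ?thesis
    unfolding frame_def B_def[symmetric] by blast
qed

text \<open>If \<open>j < j'\<close>, padding \<open>b\<close> with zero vectors makes each minor of
  size \<open>j'\<close> of \<open>b'\<close> a multiple of a minor with a zero column.\<close>

lemma frame_le: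
  assumes "frame I j' b'" "\<And>l. l < j' \<Longrightarrow> b' l \<in> lin_span j b"
  shows "j' \<le> j"
proof (rule ccontr)
  assume "\<not> j' \<le> j"
  then have j: "j < j'" by simp
  obtain m where m: "\<And>l r. l < j' \<Longrightarrow> b' l r = (\<Sum>k<j. b k r * m k l)"
    by (rule lin_span_coefficients[of j' b' j b]) (use assms(2) in auto)
  define bp where "bp k r = (if k < j then b k r else 0)" for k r
  have "b' l r = (\<Sum>k<j'. bp k r * m k l)" if "l < j'" for l r
    unfolding m[OF that] using j by (intro sum.mono_neutral_cong_left) (auto simp: bp_def)
  then have "minor j' b' \<sigma> = minor j' bp \<sigma> * det (mat j' j' (\<lambda>(k, l). m k l))" for \<sigma>
    by (intro minor_mult) auto
  moreover have "minor j' bp \<sigma> = 0" for \<sigma>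
    using j by (intro minor_zero_column[of j]) (auto simp: bp_def)
  ultimately show False
    using assms(1) by (auto simp: frame_def)
qed

lemma frame_psubset_less:
  assumes "frame I j b" "frame I j' b'" "lin_span j b \<subset> lin_span j' b'"
  shows "j < j'"
proof -
  have "\<exists>l<j'. b' l \<notin> lin_span j b"
    using lin_span_subset[of j' b' j b] assms(3) by blast
  then obtain v where v: "int_vec I v" "v \<in> lin_span j' b'" "v \<notin> lin_span j b"
    using assms(2) lin_span_base[of _ j' b'] by (auto simp: frame_def)
  have "case_nat v b l \<in> lin_span j' b'" if "l < Suc j" for l
    using that v(2) assms(3) lin_span_base[of _ j b] by (cases l) auto
  from frame_le[OF frame_extend[OF assms(1) v(1,3)] this] show ?thesis
    by simp
qed

text \<open>A nonvanishing minor cannot repeat a row, so its row selection is injective into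
  \<open>I\<close>.\<close>

lemma frame_le_card:
  assumes "finite I" "frame I j b"
  shows "j \<le> card I"
proof -
  obtain \<sigma> where \<sigma>: "\<And>i. i < j \<Longrightarrow> \<sigma> i \<in> I" "minor j b \<sigma> \<noteq> 0"
    using assms(2) by (auto simp: frame_def)
  have "inj_on \<sigma> {..<j}"
    using minor_identical_rows[of _ j _ \<sigma> b] \<sigma>(2) by (intro inj_onI) blast
  then have "card {..<j} \<le> card I"
    using \<sigma>(1) assms(1) by (intro card_inj_on_le) auto
  then show ?thesis by simp
qed

lemma frame_0: "frame I 0 b"
  by (simp add: frame_def)

lemma lin_span_0: "lin_span 0 b = {\<lambda>_. 0}"
  by (auto simp: lin_span_def)

text \<open>Among all integral bases of a subspace one minimises the size of a nonvanishing minor; every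
  other integral basis then differs from it by a matrix with \<open>|det| \<ge> 1\<close>.\<close>

lemma minimal_frame:
  fixes I :: "'i set" and b0 :: "nat \<Rightarrow> 'i \<Rightarrow> 'a::field fls"
  assumes "frame I j0 b0" "lin_span j0 b0 = W"
  obtains j b where "frame I j b" "lin_span j b = W"
    and "\<And>j' b'. frame I j' b' \<Longrightarrow> lin_span j' b' = W \<Longrightarrow> j' = j \<and>
      (\<exists>m. (\<forall>l<j. \<forall>r. b' l r = (\<Sum>k<j. b k r * m k l)) \<and>
        F_abs (det (mat j j (\<lambda>(k, l). m k l))) \<ge> 1)"
proof -
  define P where "P = (\<lambda>(j, b :: nat \<Rightarrow> 'i \<Rightarrow> 'a fls, \<sigma>). frame I j b \<and> lin_span j b = W \<and> (\<forall>i<j. \<sigma> i \<in> I) \<and> minor j b \<sigma> \<noteq> 0)"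
  \<comment> \<open>On nonzero integral elements this is the degree, so \<open>nat\<close> loses no
    information. The selection of rows is minimised along with the basis; a competing basis is
    compared on the same selection.\<close>
  define minor_size where "minor_size = (\<lambda>(j, b :: nat \<Rightarrow> 'i \<Rightarrow> 'a fls, \<sigma> :: nat \<Rightarrow> 'i). nat (- fls_subdegree (minor j b \<sigma>)))"
  obtain \<sigma>0 where "P (j0, b0, \<sigma>0)"
    using assms by (auto simp: P_def frame_def)
  then obtain t where t: "P t" "\<And>t'. P t' \<Longrightarrow> minor_size t \<le> minor_size t'"
    using ex_has_least_nat[of P _ minor_size] by blast
  obtain j b \<sigma> where t_eq: "t = (j, b, \<sigma>)"
    by (cases t)
  have b: "frame I j b" "lin_span j b = W" "\<And>i. i < j \<Longrightarrow> \<sigma> i \<in> I" "minor j b \<sigma> \<noteq> 0"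
    using t(1) by (auto simp: P_def t_eq)
  have in_Lambda: "minor j b \<sigma> \<in> range of_Lambda" if "frame I j b" for b
    using that by (intro minor_in_range_of_Lambda) (auto simp: frame_def int_vec_def)
  show thesis
  proof (rule that[OF b(1,2)])
    fix j' b' assume b': "frame I j' b'" "lin_span j' b' = W"
    have b'_in: "b' l \<in> lin_span j b" if "l < j'" for l
      using lin_span_base[OF that, of b'] b'(2) b(2) by simp
    have b_in: "b l \<in> lin_span j' b'" if "l < j" for l
      using lin_span_base[OF that, of b] b'(2) b(2) by simp
    have j': "j' = j"
      using frame_le[OF b'(1) b'_in] frame_le[OF b(1) b_in] by simp
    obtain m where m: "\<And>l r. l < j' \<Longrightarrow> b' l r = (\<Sum>k<j. b k r * m k l)"
      by (rule lin_span_coefficients[of j' b' j b]) (use b'_in in auto)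
    define d where "d = det (mat j j (\<lambda>(k, l). m k l))"
    have minor_b': "minor j b' \<tau> = minor j b \<tau> * d" for \<tau>
      unfolding d_def by (intro minor_mult) (simp add: m j')
    have d: "d \<noteq> 0"
      using b'(1) minor_b' by (auto simp: frame_def j')
    have nz: "minor j b' \<sigma> \<noteq> 0"
      using d b(4) by (simp add: minor_b')
    then have "P (j, b', \<sigma>)"
      using b' b by (simp add: P_def j')
    from t(2)[OF this] have le: "nat (- fls_subdegree (minor j b \<sigma>)) \<le> nat (- fls_subdegree (minor j b' \<sigma>))"
      by (simp add: t_eq minor_size_def)
    have "F_abs (minor j b \<sigma>) \<le> F_abs (minor j b' \<sigma>)"
    proof -
      obtain k where "F_abs (minor j b \<sigma>) = exp (real k)"
        using F_abs_range_of_Lambda[OF in_Lambda[OF b(1)] b(4)] .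
      then have "real_of_int (- fls_subdegree (minor j b \<sigma>)) = real k"
        using b(4) by (simp add: F_abs_def)
      moreover obtain k' where "F_abs (minor j b' \<sigma>) = exp (real k')"
        using F_abs_range_of_Lambda[OF in_Lambda[OF b'(1)[unfolded j']] nz] .
      then have "real_of_int (- fls_subdegree (minor j b' \<sigma>)) = real k'"
        using nz by (simp add: F_abs_def)
      ultimately show ?thesis
        using le b(4) nz by (simp add: F_abs_def)
    qed
    then have "F_abs d \<ge> 1"
      using b(4) by (simp add: minor_b' F_abs_mult)
    with m j' show "j' = j \<and> (\<exists>m. (\<forall>l<j. \<forall>r. b' l r = (\<Sum>k<j. b k r * m k l)) \<and>
        F_abs (det (mat j j (\<lambda>(k, l). m k l))) \<ge> 1)"
      unfolding d_def by blast
  qed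
qed

section \<open>Covolumes of rational subspaces\<close>

text \<open>\<open>weights\<close> says that one expanded row together with \<open>j - 1\<close>
  contracted ones does not shrink a minor of size \<open>j\<close>.\<close>

locale twist =
  fixes I :: "'i set" and f :: "'i \<Rightarrow> 'x \<Rightarrow> 'a::field fls" and w0 w1 :: "'a fls"
  assumes finite_I: "finite I"
    and w1: "w1 \<noteq> 0"
    and weights: "\<And>j. 1 \<le> j \<Longrightarrow> j \<le> card I \<Longrightarrow> 1 \<le> F_abs w0 * F_abs w1 ^ (j - 1)"
begin

text \<open>The twisted lattice: row \<open>None\<close> carries the value at \<open>x\<close> of the linear form with coefficients \<open>v\<close>,
  expanded by \<open>w0\<close>; the other rows carry the coefficients themselves, contracted by \<open>w1\<close>.
  Accordingly \<open>cov\<close> is the sup norm of the exterior product of the twisted vectors.\<close>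

definition hat :: "'x \<Rightarrow> ('i \<Rightarrow> 'a fls) \<Rightarrow> 'i option \<Rightarrow> 'a fls" where
  "hat x v r = (case r of None \<Rightarrow> w0 * (\<Sum>r\<in>I. v r * f r x) | Some r \<Rightarrow> w1 * v r)"

abbreviation rows :: "'i option set" where
  "rows \<equiv> insert None (Some ` I)"

definition vnorm :: "'x \<Rightarrow> ('i \<Rightarrow> 'a fls) \<Rightarrow> real" where
  "vnorm x v = Max ((\<lambda>r. F_abs (hat x v r)) ` rows)"

definition cov :: "nat \<Rightarrow> (nat \<Rightarrow> 'i \<Rightarrow> 'a fls) \<Rightarrow> 'x \<Rightarrow> real" where
  "cov j b x = Max ((\<lambda>\<sigma>. F_abs (minor j (\<lambda>l. hat x (b l)) \<sigma>)) ` PiE {..<j} (\<lambda>_. rows))"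

lemma vnorm_ge: "r \<in> rows \<Longrightarrow> F_abs (hat x v r) \<le> vnorm x v"
  unfolding vnorm_def using finite_I by (intro Max_ge) auto

lemma vnorm_le:
  assumes "F_abs w0 * F_abs (\<Sum>r\<in>I. v r * f r x) \<le> c" "\<And>r. r \<in> I \<Longrightarrow> F_abs w1 * F_abs (v r) \<le> c"
  shows "vnorm x v \<le> c"
  unfolding vnorm_def using finite_I assms by (subst Max_le_iff) (auto simp: hat_def F_abs_mult)

lemma finite_PiE_rows: "finite (PiE {..<j::nat} (\<lambda>_. rows))"
  using finite_I by (intro finite_PiE) auto

lemma PiE_rows_nonempty: "PiE {..<j::nat} (\<lambda>_. rows) \<noteq> {}"
  by (simp add: PiE_eq_empty_iff)

lemma cov_ge:
  assumes "\<And>i. i < j \<Longrightarrow> \<sigma> i \<in> rows"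
  shows "F_abs (minor j (\<lambda>l. hat x (b l)) \<sigma>) \<le> cov j b x"
proof -
  have "restrict \<sigma> {..<j} \<in> PiE {..<j} (\<lambda>_. rows)"
    using assms by auto
  then have "F_abs (minor j (\<lambda>l. hat x (b l)) (restrict \<sigma> {..<j})) \<le> cov j b x"
    unfolding cov_def using finite_PiE_rows by (intro Max_ge) auto
  moreover have "minor j (\<lambda>l. hat x (b l)) (restrict \<sigma> {..<j}) = minor j (\<lambda>l. hat x (b l)) \<sigma>"
    by (rule minor_cong) simp
  ultimately show ?thesis by simp
qed

lemma cov_less_iff:
  "cov j b x < c \<longleftrightarrow> (\<forall>\<sigma>\<in>PiE {..<j} (\<lambda>_. rows). F_abs (minor j (\<lambda>l. hat x (b l)) \<sigma>) < c)"
  unfolding cov_def using finite_PiE_rows PiE_rows_nonempty by (subst Max_less_iff) auto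

lemma cov_attained:
  obtains \<sigma> where "\<And>i. i < j \<Longrightarrow> \<sigma> i \<in> rows"
    and "cov j b x = F_abs (minor j (\<lambda>l. hat x (b l)) \<sigma>)"
proof -
  have "cov j b x \<in> (\<lambda>\<sigma>. F_abs (minor j (\<lambda>l. hat x (b l)) \<sigma>)) ` PiE {..<j} (\<lambda>_. rows)"
    unfolding cov_def using finite_PiE_rows PiE_rows_nonempty by (intro Max_in) auto
  then obtain \<sigma> where "\<sigma> \<in> PiE {..<j} (\<lambda>_. rows)" "cov j b x = F_abs (minor j (\<lambda>l. hat x (b l)) \<sigma>)"
    by blast
  with that show thesis by (auto simp: PiE_iff)
qed

lemma cov_nonneg: "cov j b x \<ge> 0"
  by (rule cov_attained[of j b x]) simp

lemma cov_0: "cov 0 b x = 1"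
  by (rule cov_attained[of 0 b x]) simp

text \<open>Laplace expansion along the new column; by the ultrametric inequality the number of
  summands contributes no factor.\<close>

lemma cov_extend_le: "cov (Suc j) (case_nat v b) x \<le> vnorm x v * cov j b x"
proof -
  obtain \<sigma> where \<sigma>: "\<And>i. i < Suc j \<Longrightarrow> \<sigma> i \<in> rows"
    and eq: "cov (Suc j) (case_nat v b) x = F_abs (minor (Suc j) (\<lambda>l. hat x (case_nat v b l)) \<sigma>)"
    using cov_attained[of "Suc j" "case_nat v b" x] by metis
  have vn: "vnorm x v \<ge> 0"
    using order_trans[OF F_abs_nonneg vnorm_ge[of None x v]] by simp
  show ?thesis
    unfolding eq minor_expand_column_0
  proof (rule F_abs_sum_le)
    fix i assume i: "i \<in> {..<Suc j}"
    have "F_abs ((-1) ^ i :: 'a fls) = 1"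
      by (simp add: F_abs_power)
    moreover have "F_abs (hat x v (\<sigma> i)) \<le> vnorm x v"
      using \<sigma> i by (intro vnorm_ge) auto
    moreover have "F_abs (minor j (\<lambda>l. hat x (b l)) (\<lambda>i'. \<sigma> (if i' < i then i' else Suc i'))) \<le> cov j b x"
      by (intro cov_ge \<sigma>) auto
    ultimately show "F_abs (hat x (case_nat v b 0) (\<sigma> i) * ((-1) ^ i * minor j
        (\<lambda>l. hat x (case_nat v b (Suc l))) (\<lambda>i'. \<sigma> (if i' < i then i' else Suc i'))))
        \<le> vnorm x v * cov j b x"
      using vn by (auto simp: F_abs_mult intro!: mult_mono)
  qed (use vn cov_nonneg[of j b x] in simp)
qed

lemma hat_sum:
  assumes "\<And>r. v r = (\<Sum>k<j. b k r * m k)"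
  shows "hat x v r = (\<Sum>k<j. hat x (b k) r * m k)"
proof (cases r)
  case None
  have "(\<Sum>r\<in>I. (\<Sum>k<j. b k r * m k) * f r x) = (\<Sum>k<j. (\<Sum>r\<in>I. b k r * f r x) * m k)"
    unfolding sum_distrib_right by (subst sum.swap) (simp add: mult_ac)
  with None show ?thesis
    unfolding hat_def assms
    by (simp add: sum_distrib_left[of w0 "\<lambda>k. (\<Sum>r\<in>I. b k r * f r x) * m k"] mult.assoc)
qed (simp add: hat_def assms sum_distrib_left mult.assoc)

lemma cov_base_change:
  assumes "\<And>l r. l < j \<Longrightarrow> b' l r = (\<Sum>k<j. b k r * m k l)"
    and "F_abs (det (mat j j (\<lambda>(k, l). m k l))) \<ge> 1"
  shows "cov j b x \<le> cov j b' x"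
proof -
  obtain \<sigma> where \<sigma>: "\<And>i. i < j \<Longrightarrow> \<sigma> i \<in> rows"
    and eq: "cov j b x = F_abs (minor j (\<lambda>l. hat x (b l)) \<sigma>)"
    using cov_attained[of j b x] by metis
  have "minor j (\<lambda>l. hat x (b' l)) \<sigma> = minor j (\<lambda>l. hat x (b l)) \<sigma> * det (mat j j (\<lambda>(k, l). m k l))"
    using assms(1) by (intro minor_mult hat_sum) simp
  then have "cov j b x \<le> F_abs (minor j (\<lambda>l. hat x (b' l)) \<sigma>)"
    unfolding eq using mult_left_mono[OF assms(2) F_abs_nonneg] by (simp add: F_abs_mult)
  also have "\<dots> \<le> cov j b' x"
    using \<sigma> by (rule cov_ge)
  finally show ?thesis .
qed

text \<open>Row \<open>None\<close> is the combination of the rows \<open>Some r\<close> with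
  coefficients \<open>w0 / w1 * f r x\<close>. The contracted minor of size \<open>j\<close> carries
  \<open>w1 ^ j\<close>, one factor of which cancels.\<close>

lemma hat_row_None:
  assumes "i < j" "\<And>i'. i' < j \<Longrightarrow> i' \<noteq> i \<Longrightarrow> \<sigma> i' \<in> Some ` I"
  shows "minor j (\<lambda>l. hat x (b l)) (\<sigma>(i := None)) =
    (\<Sum>r\<in>I. (w0 * w1 ^ (j - 1) * minor j b ((the \<circ> \<sigma>)(i := r))) * f r x)"
proof -
  have "minor j (\<lambda>l. hat x (b l)) (\<sigma>(i := None)) =
      (\<Sum>r\<in>I. (w0 / w1 * f r x) * minor j (\<lambda>l. hat x (b l)) (\<sigma>(i := Some r)))"
    by (rule minor_row_linear[OF assms(1)]) (use w1 in \<open>simp add: hat_def sum_distrib_left mult_ac\<close>)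
  also have "\<dots> = (\<Sum>r\<in>I. (w0 * w1 ^ (j - 1) * minor j b ((the \<circ> \<sigma>)(i := r))) * f r x)"
  proof (intro sum.cong refl)
    fix r
    have "minor j (\<lambda>l. hat x (b l)) (\<sigma>(i := Some r)) = minor j (\<lambda>l r. w1 * b l r) ((the \<circ> \<sigma>)(i := r))"
      by (rule minor_cong) (use assms(2) in \<open>force simp: hat_def\<close>)
    also have "\<dots> = w1 * w1 ^ (j - 1) * minor j b ((the \<circ> \<sigma>)(i := r))"
      unfolding minor_scale using assms(1) by (simp flip: power_Suc)
    finally show "w0 / w1 * f r x * minor j (\<lambda>l. hat x (b l)) (\<sigma>(i := Some r)) =
        w0 * w1 ^ (j - 1) * minor j b ((the \<circ> \<sigma>)(i := r)) * f r x"
      using w1 by simp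
  qed
  finally show ?thesis .
qed

text \<open>This makes goodness and continuity available for minors. Without row \<open>None\<close>
  the minor is constant, hence a multiple of \<open>f i0\<close>; with two such rows it vanishes;
  with exactly one, \<open>hat_row_None\<close> applies.\<close>

lemma minor_hat_linear:
  assumes "\<And>i. i < j \<Longrightarrow> \<sigma> i \<in> rows" and one: "i0 \<in> I" "\<And>x. f i0 x = 1"
  obtains c where "\<And>x. minor j (\<lambda>l. hat x (b l)) \<sigma> = (\<Sum>r\<in>I. c r * f r x)"
proof (cases "\<exists>i<j. \<sigma> i = None")
  case False
  then have "\<And>i. i < j \<Longrightarrow> \<sigma> i \<in> Some ` I"
    using assms(1) by fastforce
  then have eq: "minor j (\<lambda>l. hat x (b l)) \<sigma> = minor j (\<lambda>l r. w1 * b l r) (the \<circ> \<sigma>)" for x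
    by (intro minor_cong) (force simp: hat_def)
  show thesis
    by (rule that[of "\<lambda>r. if r = i0 then minor j (\<lambda>l r. w1 * b l r) (the \<circ> \<sigma>) else 0"])
      (use one finite_I in \<open>simp add: eq if_distrib[of "\<lambda>x. x * _"] cong: if_cong\<close>)
next
  case True
  then obtain i where i: "i < j" "\<sigma> i = None" by blast
  show thesis
  proof (cases "\<exists>i'<j. i' \<noteq> i \<and> \<sigma> i' = None")
    case True
    then obtain i' where "i' < j" "i' \<noteq> i" "\<sigma> i' = None" by blast
    with i have "minor j (\<lambda>l. hat x (b l)) \<sigma> = 0" for x
      by (intro minor_identical_rows[of i j i']) auto
    then show thesis
      by (intro that[of "\<lambda>_. 0"]) simp
  next
    case False
    have "\<sigma>(i := None) = \<sigma>"
      using i by auto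
    moreover have "\<sigma> i' \<in> Some ` I" if "i' < j" "i' \<noteq> i" for i'
      using assms(1)[OF that(1)] False that by blast
    with i(1) have "minor j (\<lambda>l. hat x (b l)) (\<sigma>(i := None)) =
        (\<Sum>r\<in>I. (w0 * w1 ^ (j - 1) * minor j b ((the \<circ> \<sigma>)(i := r))) * f r x)" for x
      by (intro hat_row_None) auto
    ultimately show thesis
      by (intro that[of "\<lambda>r. w0 * w1 ^ (j - 1) * minor j b ((the \<circ> \<sigma>)(i := r))"]) simp
  qed
qed

text \<open>Replacing the first row of a nonvanishing integral minor by row \<open>None\<close> gives a combination of
  the \<open>f r\<close> with one coefficient of absolute value at least 1.\<close>

lemma cov_lower_bound:
  assumes "frame I j b" "1 \<le> j"
  obtains c where "\<And>x. F_abs (\<Sum>r\<in>I. c r * f r x) \<le> cov j b x" "\<exists>r\<in>I. F_abs (c r) \<ge> 1"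
proof -
  obtain \<sigma> where \<sigma>: "\<And>i. i < j \<Longrightarrow> \<sigma> i \<in> I" "minor j b \<sigma> \<noteq> 0"
    using assms(1) by (auto simp: frame_def)
  define c where "c r = w0 * w1 ^ (j - 1) * minor j b (\<sigma>(0 := r))" for r
  show thesis
  proof (rule that[of c])
    fix x
    have "(\<Sum>r\<in>I. c r * f r x) = minor j (\<lambda>l. hat x (b l)) ((Some \<circ> \<sigma>)(0 := None))"
      unfolding c_def using assms(2) \<sigma>(1) by (subst hat_row_None) (auto simp: comp_def)
    also have "F_abs \<dots> \<le> cov j b x"
      using \<sigma>(1) by (intro cov_ge) auto
    finally show "F_abs (\<Sum>r\<in>I. c r * f r x) \<le> cov j b x" .
  next
    have "minor j b \<sigma> \<in> range of_Lambda"
      using assms(1) by (intro minor_in_range_of_Lambda) (auto simp: frame_def int_vec_def)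
    then obtain m :: nat where m: "F_abs (minor j b \<sigma>) = exp (real m)"
      using \<sigma>(2) by (rule F_abs_range_of_Lambda)
    have "1 * 1 \<le> F_abs w0 * F_abs w1 ^ (j - 1) * F_abs (minor j b \<sigma>)"
      using weights[OF assms(2) frame_le_card[OF finite_I assms(1)]] m by (intro mult_mono) auto
    moreover have "\<sigma>(0 := \<sigma> 0) = \<sigma>" by simp
    ultimately have "F_abs (c (\<sigma> 0)) \<ge> 1"
      unfolding c_def by (simp add: F_abs_mult F_abs_power)
    moreover have "\<sigma> 0 \<in> I"
      using \<sigma>(1) assms(2) by simp
    ultimately show "\<exists>r\<in>I. F_abs (c r) \<ge> 1" by blast
  qed
qed

text \<open>The zero subspace is excluded, as it has no row to replace by values at
  \<open>x\<close>. Its covolume 1 reappears as the starting point of flags.\<close>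

definition subspaces :: "('i \<Rightarrow> 'a fls) set set" where
  "subspaces = {W. \<exists>j b. 1 \<le> j \<and> frame I j b \<and> lin_span j b = W}"

text \<open>One basis can minimise the covolume at all \<open>x\<close> simultaneously because the
  determinant of a change of basis does not depend on \<open>x\<close>.\<close>

definition is_basis :: "('i \<Rightarrow> 'a fls) set \<Rightarrow> nat \<times> (nat \<Rightarrow> 'i \<Rightarrow> 'a fls) \<Rightarrow> bool" where
  "is_basis W p \<longleftrightarrow> frame I (fst p) (snd p) \<and> lin_span (fst p) (snd p) = W \<and>
    (\<forall>j' b'. frame I j' b' \<longrightarrow> lin_span j' b' = W \<longrightarrow> j' = fst p \<and>
      (\<forall>x. cov (fst p) (snd p) x \<le> cov j' b' x))"

definition basis :: "('i \<Rightarrow> 'a fls) set \<Rightarrow> nat \<times> (nat \<Rightarrow> 'i \<Rightarrow> 'a fls)" where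
  "basis W = (SOME p. is_basis W p)"

definition \<psi> :: "('i \<Rightarrow> 'a fls) set \<Rightarrow> 'x \<Rightarrow> real" where
  "\<psi> W = cov (fst (basis W)) (snd (basis W))"

definition rk :: "('i \<Rightarrow> 'a fls) set \<Rightarrow> nat" where
  "rk W = fst (basis W)"

definition cmp :: "('i \<Rightarrow> 'a fls) set \<Rightarrow> ('i \<Rightarrow> 'a fls) set \<Rightarrow> bool" where
  "cmp V W \<longleftrightarrow> V \<subset> W \<or> W \<subset> V"

lemma is_basis_basis:
  assumes "W \<in> subspaces"
  shows "is_basis W (basis W)"
proof -
  obtain j0 b0 where "frame I j0 b0" "lin_span j0 b0 = W"
    using assms by (auto simp: subspaces_def)
  then obtain j b where b: "frame I j b" "lin_span j b = W"
    and min: "\<And>j' b'. frame I j' b' \<Longrightarrow> lin_span j' b' = W \<Longrightarrow> j' = j \<and>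
      (\<exists>m. (\<forall>l<j. \<forall>r. b' l r = (\<Sum>k<j. b k r * m k l)) \<and>
        F_abs (det (mat j j (\<lambda>(k, l). m k l))) \<ge> 1)"
    by (rule minimal_frame) blast
  have "is_basis W (j, b)"
    unfolding is_basis_def fst_conv snd_conv
  proof (intro conjI allI impI b)
    fix j' b' x assume b': "frame I j' b'" "lin_span j' b' = W"
    show j': "j' = j"
      using min[OF b'] by blast
    obtain m where "\<And>l r. l < j \<Longrightarrow> b' l r = (\<Sum>k<j. b k r * m k l)"
        "F_abs (det (mat j j (\<lambda>(k, l). m k l))) \<ge> 1"
      using min[OF b'] by metis
    then show "cov j b x \<le> cov j' b' x"
      unfolding j' by (rule cov_base_change)
  qed
  then show ?thesis
    unfolding basis_def by (rule someI)
qed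

lemma basis_frame:
  assumes "W \<in> subspaces"
  shows "frame I (rk W) (snd (basis W))" "lin_span (rk W) (snd (basis W)) = W" "1 \<le> rk W"
proof -
  note B = is_basis_basis[OF assms, unfolded is_basis_def, folded rk_def]
  show "frame I (rk W) (snd (basis W))" "lin_span (rk W) (snd (basis W)) = W"
    using B by auto
  show "1 \<le> rk W"
    using B assms unfolding subspaces_def by auto
qed

lemma \<psi>_le_cov:
  assumes "1 \<le> j" "frame I j b"
  shows "lin_span j b \<in> subspaces" "\<psi> (lin_span j b) x \<le> cov j b x"
proof -
  show W: "lin_span j b \<in> subspaces"
    using assms by (auto simp: subspaces_def)
  show "\<psi> (lin_span j b) x \<le> cov j b x"
    using is_basis_basis[OF W] assms(2) unfolding is_basis_def \<psi>_def by blast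
qed

lemma rk_le: "W \<in> subspaces \<Longrightarrow> rk W \<le> card I"
  using basis_frame(1) frame_le_card finite_I by blast

lemma rk_less:
  assumes "V \<in> subspaces" "W \<in> subspaces" "V \<subset> W"
  shows "rk V < rk W"
  by (rule frame_psubset_less[of I _ "snd (basis V)" _ "snd (basis W)"])
    (use basis_frame[OF assms(1)] basis_frame[OF assms(2)] assms(3) in auto)

text \<open>The flag that marks \<open>x\<close> is refined by adjoining \<open>v\<close> to its largest member not containing
  \<open>v\<close>; the new subspace is comparable to the whole flag, so its covolume is at least \<open>\<epsilon>\<close>.\<close>

lemma marked_vnorm_ge:
  assumes "marked cmp \<psi> \<epsilon> \<rho> subspaces x" "\<epsilon> \<le> \<rho>" "\<rho> \<le> 1"
    and v: "int_vec I v" "v \<noteq> (\<lambda>_. 0)"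
  shows "\<epsilon> \<le> vnorm x v"
proof -
  obtain F where F: "F \<subseteq> subspaces" "\<And>W. W \<in> F \<Longrightarrow> \<epsilon> \<le> \<psi> W x \<and> \<psi> W x < \<rho>"
      "\<And>V W. V \<in> F \<Longrightarrow> W \<in> F \<Longrightarrow> V = W \<or> cmp V W"
      "\<And>W. W \<in> subspaces \<Longrightarrow> (\<forall>V\<in>F. cmp W V) \<Longrightarrow> \<rho> \<le> \<psi> W x"
    using assms(1) unfolding marked_def by (elim exE conjE) metis
  define G where "G = {W \<in> F. v \<notin> W}"
  obtain j b where jb: "frame I j b" "v \<notin> lin_span j b" "cov j b x \<le> 1"
      "\<And>W. W \<in> F \<Longrightarrow> W \<subseteq> lin_span j b \<or> (lin_span j b \<subseteq> W \<and> v \<in> W)"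
  proof (cases "G = {}")
    \<comment> \<open>If \<open>v\<close> lies in every member of the flag, the zero subspace takes
      the place of the largest member that does not contain \<open>v\<close>.\<close>
    case True
    show thesis
    proof (rule that[of 0 "\<lambda>_ _. 0"])
      fix W assume W: "W \<in> F"
      with F(1) obtain j b where "lin_span j b = W"
        by (auto simp: subspaces_def)
      then have "(\<lambda>_. 0) \<in> W"
        unfolding lin_span_def by (auto intro!: exI[of _ "\<lambda>_. 0"])
      with W True show "W \<subseteq> lin_span 0 (\<lambda>_ _. 0) \<or> (lin_span 0 (\<lambda>_ _. 0) \<subseteq> W \<and> v \<in> W)"
        by (auto simp: lin_span_0 G_def)
    qed (use v in \<open>auto simp: frame_0 lin_span_0 cov_0\<close>)
  next
    case False
    have "\<And>W. W \<in> G \<Longrightarrow> rk W < Suc (card I)"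
      using rk_le F(1) by (fastforce simp: G_def)
    with False obtain W0 where W0: "W0 \<in> G" "\<And>W. W \<in> G \<Longrightarrow> rk W \<le> rk W0"
      using ex_has_greatest_nat[of "\<lambda>W. W \<in> G" _ rk "Suc (card I)"] by blast
    have W0F: "W0 \<in> F" "W0 \<in> subspaces" "v \<notin> W0"
      using W0(1) F(1) by (auto simp: G_def)
    show thesis
    proof (rule that[of "rk W0" "snd (basis W0)"])
      show "frame I (rk W0) (snd (basis W0))" "v \<notin> lin_span (rk W0) (snd (basis W0))"
        using basis_frame[OF W0F(2)] W0F(3) by auto
      show "cov (rk W0) (snd (basis W0)) x \<le> 1"
        using F(2)[OF W0F(1)] assms(3) by (simp add: \<psi>_def rk_def)
      fix W assume W: "W \<in> F"
      have "W \<subseteq> W0" if "\<not> (W0 \<subseteq> W \<and> v \<in> W)"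
      proof (rule ccontr)
        assume nle: "\<not> W \<subseteq> W0"
        then have sub: "W0 \<subset> W"
          using F(3)[OF W W0F(1)] by (auto simp: cmp_def)
        with that W have "W \<in> G"
          by (auto simp: G_def)
        moreover have "rk W0 < rk W"
          using rk_less[OF W0F(2) _ sub] F(1) W by blast
        ultimately show False
          using W0(2)[of W] by simp
      qed
      then show "W \<subseteq> lin_span (rk W0) (snd (basis W0)) \<or> (lin_span (rk W0) (snd (basis W0)) \<subseteq> W \<and> v \<in> W)"
        unfolding basis_frame(2)[OF W0F(2)] by blast
    qed
  qed
  define W1 where "W1 = lin_span (Suc j) (case_nat v b)"
  have ext: "frame I (Suc j) (case_nat v b)"
    using frame_extend jb(1) v(1) jb(2) by blast
  have W1: "W1 \<in> subspaces" "\<psi> W1 x \<le> cov (Suc j) (case_nat v b) x"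
    unfolding W1_def using \<psi>_le_cov[OF _ ext] by auto
  have vW1: "v \<in> W1"
    unfolding W1_def using lin_span_base[of 0 "Suc j" "case_nat v b"] by simp
  have bW1: "lin_span j b \<subseteq> W1"
    unfolding W1_def
  proof (rule lin_span_subset)
    fix l assume "l < j"
    then show "b l \<in> lin_span (Suc j) (case_nat v b)"
      using lin_span_base[of "Suc l" "Suc j" "case_nat v b"] by simp
  qed
  \<comment> \<open>\<open>W1\<close> may itself belong to the flag, whereas \<open>cmp\<close> is
    strict; the lower bound built into the marking then replaces maximality.\<close>
  have "\<epsilon> \<le> \<psi> W1 x"
  proof (cases "W1 \<in> F")
    case True
    then show ?thesis
      using F(2) by blast
  next
    case False
    have "cmp W1 W" if W: "W \<in> F" for W
    proof (cases "W \<subseteq> lin_span j b")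
      case True
      then show ?thesis
        using vW1 bW1 jb(2) by (auto simp: cmp_def)
    next
      case Fals: False
      then have "lin_span j b \<subseteq> W" "v \<in> W"
        using jb(4)[OF W] by auto
      moreover obtain j' b' where b': "lin_span j' b' = W"
        using F(1) W by (auto simp: subspaces_def)
      ultimately have "W1 \<subseteq> W"
        unfolding W1_def b'[symmetric] using lin_span_base[of _ j b]
        by (intro lin_span_subset) (auto split: nat.split simp: less_Suc_eq_0_disj)
      with False W show ?thesis
        by (auto simp: cmp_def)
    qed
    then have "\<rho> \<le> \<psi> W1 x"
      using F(4)[OF W1(1)] by blast
    with assms(2) show ?thesis by simp
  qed
  also have "\<dots> \<le> vnorm x v * cov j b x"
    using W1(2) cov_extend_le[of j v b x] by linarith
  also have "\<dots> \<le> vnorm x v * 1"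
    using order_trans[OF F_abs_nonneg vnorm_ge[of None x v]] jb(3) by (intro mult_left_mono) auto
  finally show ?thesis by simp
qed

end

section \<open>Quantitative nondivergence\<close>

text \<open>\<open>K\<close> and \<open>\<rho>\<close> are fixed before the weights; this is the
  uniformity in time that makes the bounds summable later.\<close>

theorem quantitative_nondivergence:
  fixes \<mu> :: "('q::{finite,field} fls ^ 'd::finite) measure"
    and f :: "'i \<Rightarrow> 'q fls ^ 'd \<Rightarrow> 'q fls"
  assumes "open U" "radon_measure \<mu>" "federer_on U \<mu>"
    and good: "\<And>c. good_fun C \<alpha> U \<mu> (\<lambda>x. \<Sum>r\<in>I. c r * f r x)" and "C > 0" "\<alpha> > 0"
    and I: "finite I" "i0 \<in> I" "\<And>x. f i0 x = 1"
    and x0: "x0 \<in> msupp \<mu>" "expball x0 n0 \<subseteq> U"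
    and nonplanar: "\<And>c. (\<And>y. y \<in> expball x0 n0 \<inter> msupp \<mu> \<Longrightarrow> (\<Sum>r\<in>I. c r * f r y) = 0) \<Longrightarrow>
      (\<forall>r\<in>I. c r = 0)"
  obtains K :: ennreal and \<rho> :: real where "K < \<infinity>" "0 < \<rho>" "\<rho> \<le> 1"
    and "\<And>w0 w1 \<epsilon>. twist I w0 w1 \<Longrightarrow> 0 < \<epsilon> \<Longrightarrow> \<epsilon> \<le> \<rho> \<Longrightarrow> \<exists>A\<in>sets \<mu>.
      {y \<in> expball x0 n0 \<inter> msupp \<mu>. \<exists>v. int_vec I v \<and> v \<noteq> (\<lambda>_. 0) \<and> twist.vnorm I f w0 w1 y v < \<epsilon>} \<subseteq> A \<and>
      emeasure \<mu> A \<le> K * ennreal (\<epsilon> powr \<alpha>)"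
proof -
  define Y where "Y = expball x0 n0 \<inter> msupp \<mu>"
  have "\<exists>Z C. finite Z \<and> Z \<subseteq> Y \<and> C > 0 \<and>
    (\<forall>c m. m \<ge> 0 \<longrightarrow> (\<forall>z\<in>Z. F_abs (\<Sum>r\<in>I. c r * f r z) \<le> m) \<longrightarrow> (\<forall>r\<in>I. F_abs (c r) \<le> C * m))"
    unfolding Y_def by (rule independent_coefficient_bound[OF I(1)]) (rule nonplanar)
  then obtain Z C0 where Z: "Z \<subseteq> Y" and C0: "C0 > 0"
    and coeff: "\<And>c m. m \<ge> 0 \<Longrightarrow> \<forall>z\<in>Z. F_abs (\<Sum>r\<in>I. c r * f r z) \<le> m \<Longrightarrow>
      \<forall>r\<in>I. F_abs (c r) \<le> C0 * m"
    by metis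
  \<comment> \<open>With \<open>C0 * \<rho> < 1\<close>, a combination having a coefficient of size
    at least 1 cannot stay within \<rho> on all of \<open>Z\<close>.\<close>
  define \<rho> where "\<rho> = min 1 (1 / (2 * C0))"
  have \<rho>: "0 < \<rho>" "\<rho> \<le> 1" "C0 * \<rho> < 1"
    using C0 by (auto simp: \<rho>_def min_def field_simps)
  obtain D :: real where D: "D > 0" "\<And>x n. x \<in> msupp \<mu> \<Longrightarrow> expball x (n + 1) \<subseteq> U \<Longrightarrow>
      compact (expball x n) \<Longrightarrow> emeasure \<mu> (expball x (n + 1)) \<le> ennreal D * emeasure \<mu> (expball x n)"
    using federer_on_expball[OF assms(3,2)] by blast
  have sets: "sets \<mu> = sets borel"
    using assms(2) by (simp add: radon_measure_def)
  have cont: "continuous_on U (\<lambda>x. \<Sum>r\<in>I. c r * f r x)" for c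
    using good[of c] by (simp add: good_fun_def)
  have expball_sets: "expball x n \<in> sets \<mu>" for x n
    unfolding sets by (rule borel_open[OF open_expball])
  \<comment> \<open>Ranks lie in \<open>{..card I}\<close>, which has \<open>card I + 1\<close>
    elements.\<close>
  define m where "m = Suc (card I)"
  define K where "K = nondiv_const (ennreal D) m * ennreal (C * (1 / \<rho>) powr \<alpha>) * emeasure \<mu> (expball x0 n0)"
  show thesis
  proof (rule that[of K \<rho>])
    have "emeasure \<mu> (expball x0 n0) < \<infinity>"
      using assms(2) compact_expball unfolding radon_measure_def by fastforce
    then show "K < \<infinity>"
      unfolding K_def using nondiv_const_less_top[of "ennreal D" m] by (simp add: ennreal_mult_less_top)
    show "0 < \<rho>" "\<rho> \<le> 1"
      using \<rho> by auto
    fix w0 w1 :: "'q fls" and \<epsilon> :: real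
    assume tw: "twist I w0 w1" and \<epsilon>: "0 < \<epsilon>" "\<epsilon> \<le> \<rho>"
    interpret twist I f w0 w1 by (rule tw)
    have \<psi>_eq: "\<psi> W x = cov (rk W) (snd (basis W)) x" for W x
      by (simp add: \<psi>_def rk_def)
    have open_sublevel: "open {x \<in> U. F_abs (minor j (\<lambda>l. hat x (b l)) \<sigma>) < c}"
      if \<sigma>: "\<And>i. i < j \<Longrightarrow> \<sigma> i \<in> rows" for j b \<sigma> c
    proof -
      obtain e where "\<And>x. minor j (\<lambda>l. hat x (b l)) \<sigma> = (\<Sum>r\<in>I. e r * f r x)"
        by (rule minor_hat_linear[where b = b and j = j and \<sigma> = \<sigma>, OF \<sigma> I(2,3)]) (assumption, rule that)
      then show ?thesis
        using open_F_abs_sublevel[OF cont[of e] assms(1)] by simp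
    qed
    interpret nondivergence \<mu> expball "msupp \<mu>" "expball x0 n0" subspaces rk cmp \<psi> \<epsilon> \<rho>
      "ennreal (C * (\<epsilon> / \<rho>) powr \<alpha>)" "ennreal D"
    proof
      show "x \<in> expball x n" for x :: "'q fls ^ 'd" and n
        by (rule expball_self)
      show "y \<in> expball x n \<Longrightarrow> expball y n = expball x n" for x y :: "'q fls ^ 'd" and n
        by (rule expball_eq)
      show "expball x n \<subseteq> expball x (n + 1)" for x :: "'q fls ^ 'd" and n
        by (rule expball_mono) simp
      show "expball x n \<in> sets \<mu>" for x n
        by (rule expball_sets)
      show "countable {expball y l |y. y \<in> expball x0 n0}" for l
        by (rule countable_finite[OF finite_expball_subballs])
      show "emeasure \<mu> (expball x (n + 1)) \<le> ennreal D * emeasure \<mu> (expball x n)"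
        if "x \<in> msupp \<mu>" "expball x (n + 1) \<subseteq> expball x0 n0" for x n
        using D(2)[OF that(1)] that(2) x0(2) compact_expball by blast
      show "cmp V W \<Longrightarrow> cmp W V" for V W
        by (auto simp: cmp_def)
      show "rk V \<noteq> rk W" if "V \<in> subspaces" "W \<in> subspaces" "cmp V W" for V W
        using rk_less[OF that(1,2)] rk_less[OF that(2,1)] that(3) unfolding cmp_def by (elim disjE) simp_all
      show "finite (rk ` subspaces)"
        by (rule finite_subset[of _ "{..card I}"]) (use rk_le in auto)
      show "\<exists>A\<in>sets \<mu>. {z \<in> expball x n \<inter> msupp \<mu>. \<psi> W z < \<epsilon>} \<subseteq> A \<and>
          emeasure \<mu> A \<le> ennreal (C * (\<epsilon> / \<rho>) powr \<alpha>) * emeasure \<mu> (expball x n)"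
        if W: "W \<in> subspaces" and x: "x \<in> msupp \<mu>" "expball x n \<subseteq> expball x0 n0"
          and y: "y \<in> expball x n \<inter> msupp \<mu>" "\<rho> \<le> \<psi> W y" for W x n y
      proof -
        \<comment> \<open>The covolume is a maximum, yet one linear combination suffices: the minor
          attaining it at \<open>y\<close> is at least \<rho> there and at most
          \<open>\<psi> W\<close> everywhere, so its sublevel set contains that of
          \<open>\<psi> W\<close>.\<close>
        obtain \<sigma> where \<sigma>: "\<And>i. i < rk W \<Longrightarrow> \<sigma> i \<in> rows"
          and eq: "cov (rk W) (snd (basis W)) y = F_abs (minor (rk W) (\<lambda>l. hat y (snd (basis W) l)) \<sigma>)"
          by (rule cov_attained[of "rk W" "snd (basis W)" y]) (rule that)
        obtain e where e: "\<And>x. minor (rk W) (\<lambda>l. hat x (snd (basis W) l)) \<sigma> = (\<Sum>r\<in>I. e r * f r x)"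
          by (rule minor_hat_linear[where b = "snd (basis W)" and j = "rk W" and \<sigma> = \<sigma>, OF \<sigma> I(2,3)]) (assumption, rule that)
        define g where "g z = (\<Sum>r\<in>I. e r * f r z)" for z
        have cbU: "expball x n \<subseteq> U"
          using x(2) x0(2) by blast
        have gy: "\<rho> \<le> F_abs (g y)"
          using y(2) unfolding \<psi>_eq eq e g_def .
        have "F_abs (g z) \<le> \<psi> W z" for z
          unfolding g_def e[symmetric] \<psi>_eq by (rule cov_ge[OF \<sigma>])
        then have sub: "{z \<in> expball x n \<inter> msupp \<mu>. \<psi> W z < \<epsilon>} \<subseteq> {z \<in> expball x n. F_abs (g z) < \<epsilon>}"
          using le_less_trans by blast
        have "{z \<in> expball x n. F_abs (g z) < \<epsilon>} = expball x n \<inter> {z \<in> U. F_abs (g z) < \<epsilon>}"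
          using cbU by blast
        moreover have "open {z \<in> U. F_abs (g z) < \<epsilon>}"
          unfolding g_def by (rule open_F_abs_sublevel[OF cont assms(1)])
        ultimately have "{z \<in> expball x n. F_abs (g z) < \<epsilon>} \<in> sets \<mu>"
          unfolding sets using open_expball[of x n] by auto
        moreover have "emeasure \<mu> {z \<in> expball x n. F_abs (g z) < \<epsilon>}
            \<le> ennreal (C * (\<epsilon> / \<rho>) powr \<alpha>) * emeasure \<mu> (expball x n)"
          by (rule good_fun_expball[OF good[of e, folded g_def] assms(1,5,6) x(1) cbU y(1) \<rho>(1) gy \<epsilon>(1)])
        ultimately show ?thesis
          using sub by blast
      qed
      show "\<exists>n. \<forall>y\<in>expball x n. \<psi> W y < \<rho>"
        if W: "W \<in> subspaces" and x: "x \<in> msupp \<mu> \<inter> expball x0 n0" "\<psi> W x < \<rho>" for W x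
      proof -
        define V where "V = (\<Inter>\<sigma>\<in>PiE {..<rk W} (\<lambda>_. rows).
            {z \<in> U. F_abs (minor (rk W) (\<lambda>l. hat z (snd (basis W) l)) \<sigma>) < \<rho>})"
        have "open V"
          unfolding V_def using finite_PiE_rows by (intro open_INT ballI open_sublevel) (auto simp: PiE_iff)
        moreover have "x \<in> V"
          using x x0(2) unfolding V_def \<psi>_eq cov_less_iff by auto
        ultimately obtain n :: nat where "expball x (- int n) \<subseteq> V"
          by (rule open_contains_expball)
        moreover have "\<psi> W z < \<rho>" if "z \<in> V" for z
          using that unfolding V_def \<psi>_eq cov_less_iff by auto
        ultimately show ?thesis by blast
      qed
    qed
    have large: "\<exists>y\<in>expball x0 n0 \<inter> msupp \<mu>. \<rho> \<le> \<psi> W y" if W: "W \<in> subspaces" for W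
    proof (rule ccontr)
      assume small: "\<not> ?thesis"
      obtain e where "\<And>x. F_abs (\<Sum>r\<in>I. e r * f r x) \<le> cov (rk W) (snd (basis W)) x"
          and e1: "\<exists>r\<in>I. F_abs (e r) \<ge> 1"
        by (rule cov_lower_bound[OF basis_frame(1,3)[OF W]]) (rule that)
      then have e: "F_abs (\<Sum>r\<in>I. e r * f r x) \<le> \<psi> W x" for x
        by (simp add: \<psi>_eq)
      have "\<forall>z\<in>Z. F_abs (\<Sum>r\<in>I. e r * f r z) \<le> \<rho>"
      proof
        fix z assume "z \<in> Z"
        then have "\<psi> W z < \<rho>"
          using small Z by (auto simp: Y_def not_le)
        with e[of z] show "F_abs (\<Sum>r\<in>I. e r * f r z) \<le> \<rho>"
          by linarith
      qed
      then have "\<forall>r\<in>I. F_abs (e r) \<le> C0 * \<rho>"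
        using \<rho>(1) by (intro coeff) auto
      with e1 \<rho>(3) show False by fastforce
    qed
    have "card (rk ` subspaces) \<le> m"
    proof -
      have "card (rk ` subspaces) \<le> card {..card I}"
        using rk_le by (intro card_mono) auto
      then show ?thesis by (simp add: m_def)
    qed
    from unmarked_le[OF order_refl this x0(1) order_refl large]
    obtain A where A: "A \<in> sets \<mu>"
        "{y \<in> expball x0 n0 \<inter> msupp \<mu>. \<not> marked cmp \<psi> \<epsilon> \<rho> subspaces y} \<subseteq> A"
        "emeasure \<mu> A \<le> nondiv_const (ennreal D) m * ennreal (C * (\<epsilon> / \<rho>) powr \<alpha>) * emeasure \<mu> (expball x0 n0)"
      by blast
    have "C * (\<epsilon> / \<rho>) powr \<alpha> = C * (1 / \<rho>) powr \<alpha> * \<epsilon> powr \<alpha>"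
      using \<epsilon> \<rho> by (simp add: powr_divide)
    then have "ennreal (C * (\<epsilon> / \<rho>) powr \<alpha>) = ennreal (C * (1 / \<rho>) powr \<alpha>) * ennreal (\<epsilon> powr \<alpha>)"
      using assms(5) by (simp add: ennreal_mult mult.assoc)
    with A(3) have "emeasure \<mu> A \<le> K * ennreal (\<epsilon> powr \<alpha>)"
      by (simp add: K_def mult_ac)
    moreover have "{y \<in> expball x0 n0 \<inter> msupp \<mu>. \<exists>v. int_vec I v \<and> v \<noteq> (\<lambda>_. 0) \<and> vnorm y v < \<epsilon>} \<subseteq> A"
      using A(2) marked_vnorm_ge[OF _ \<epsilon>(2) \<rho>(2)] by (fastforce simp: not_le[symmetric])
    ultimately show "\<exists>A\<in>sets \<mu>.
      {y \<in> expball x0 n0 \<inter> msupp \<mu>. \<exists>v. int_vec I v \<and> v \<noteq> (\<lambda>_. 0) \<and> vnorm y v < \<epsilon>} \<subseteq> A \<and>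
      emeasure \<mu> A \<le> K * ennreal (\<epsilon> powr \<alpha>)"
      using A(1) by blast
  qed
qed

section \<open>Polynomials and very well approximable points\<close>

definition expos :: "nat \<Rightarrow> 'd::finite expo set" where
  "expos k = {m. expo_deg m \<le> k}"

lemma expo_deg_0 [simp]: "expo_deg 0 = 0"
  by (simp add: expo_deg_def)

lemma expo_deg_eq_0_iff: "expo_deg m = 0 \<longleftrightarrow> m = 0"
proof
  assume "expo_deg m = 0"
  then have "Poly_Mapping.lookup m i = 0" for i
    by (simp add: expo_deg_def)
  then show "m = 0"
    by (intro poly_mapping_eqI) simp
qed simp

lemma expos_eq: "expos k = insert 0 (nonconst_expos k)"
  unfolding set_eq_iff expos_def nonconst_expos_def insert_iff mem_Collect_eq
    expo_deg_eq_0_iff[symmetric]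
  by auto

lemma monom_at_0 [simp]: "monom_at 0 x = 1"
  by (simp add: monom_at_def)

text \<open>Stars and bars: the exponent vector is completed by the slack \<open>k - expo_deg m\<close>.\<close>

lemma finite_card_expos:
  shows finite_expos: "finite (expos k :: 'd::finite expo set)"
    and card_expos: "card (expos k :: 'd expo set) \<le> (k + CARD('d)) choose CARD('d)"
proof -
  obtain ds :: "'d list" where ds: "set ds = UNIV" "distinct ds"
    using finite_distinct_list[OF finite] by metis
  have len: "length ds = CARD('d)"
    using distinct_card[OF ds(2)] ds(1) by simp
  define L where "L = {l :: nat list. length l = Suc CARD('d) \<and> sum_list l = k}"
  define g :: "'d expo \<Rightarrow> nat list" where
    "g m = (k - expo_deg m) # map (Poly_Mapping.lookup m) ds" for m
  have card_L: "card L = (k + CARD('d)) choose CARD('d)"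
    unfolding L_def card_length_sum_list by (simp add: binomial_symmetric[of k "k + CARD('d)"])
  have "card L \<noteq> 0"
    unfolding card_L by simp
  then have fin: "finite L"
    using card_ge_0_finite by blast
  have inj: "inj_on g (expos k)"
  proof (rule inj_onI)
    fix m m' assume "g m = g m'"
    then have "Poly_Mapping.lookup m i = Poly_Mapping.lookup m' i" for i
      using ds(1) by (auto simp: g_def)
    then show "m = m'"
      by (rule poly_mapping_eqI)
  qed
  have "sum_list (map (Poly_Mapping.lookup m) ds) = expo_deg m" for m
    using sum.distinct_set_conv_list[OF ds(2), of "Poly_Mapping.lookup m"] ds(1) by (simp add: expo_deg_def)
  then have sub: "g ` expos k \<subseteq> L"
    by (auto simp: g_def L_def expos_def len)
  show "finite (expos k :: 'd expo set)"
    using inj sub fin by (metis finite_imageD finite_subset)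
  show "card (expos k :: 'd expo set) \<le> (k + CARD('d)) choose CARD('d)"
    using card_inj_on_le[OF inj sub fin] card_L by simp
qed

abbreviation coeff_vec :: "('q::field, 'd::finite) mpolyL \<Rightarrow> 'd expo \<Rightarrow> 'q fls" where
  "coeff_vec P m \<equiv> of_Lambda (Poly_Mapping.lookup P m)"

lemma total_degree_le_keys: "total_degree_le k P \<longleftrightarrow> Poly_Mapping.keys P \<subseteq> expos k"
  by (auto simp: total_degree_le_def expos_def)

lemma int_vec_coeff_vec:
  assumes "total_degree_le k P"
  shows "int_vec (expos k) (coeff_vec P)"
proof -
  have "Poly_Mapping.lookup P m = 0" if "m \<notin> expos k" for m
    using assms that by (meson in_keys_iff subsetD total_degree_le_keys)
  then show ?thesis
    by (simp add: int_vec_def)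
qed

lemma coeff_vec_nonzero: "P \<noteq> 0 \<Longrightarrow> coeff_vec P \<noteq> (\<lambda>_. 0)"
proof
  assume "P \<noteq> 0" "coeff_vec P = (\<lambda>_. 0)"
  then have "Poly_Mapping.lookup P m = 0" for m
    by (simp add: fun_eq_iff)
  then have "P = 0"
    by (intro poly_mapping_eqI) simp
  with \<open>P \<noteq> 0\<close> show False by simp
qed

lemma eval_at_eq:
  assumes "total_degree_le k P"
  shows "eval_at P x = (\<Sum>m\<in>expos k. coeff_vec P m * monom_at m x)"
  unfolding eval_at_def
  by (rule sum.mono_neutral_left)
    (use assms finite_expos in \<open>auto simp: total_degree_le_keys in_keys_iff\<close>)

lemma finite_range_coeff_vec: "finite (range (\<lambda>m. F_abs (coeff_vec P m)))"
proof (rule finite_subset)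
  show "range (\<lambda>m. F_abs (coeff_vec P m)) \<subseteq> insert 0 ((\<lambda>m. F_abs (coeff_vec P m)) ` Poly_Mapping.keys P)"
    by (auto simp: in_keys_iff)
qed simp

lemma height_ge: "F_abs (coeff_vec P m) \<le> height P"
  unfolding height_def using finite_range_coeff_vec by (rule Max_ge) blast

lemma height_0 [simp]: "height 0 = 0"
  by (simp add: height_def)

text \<open>The maximum is the size of a nonzero integral coefficient. The integer \<open>h\<close>
  becomes the discrete time of the limsup argument.\<close>

lemma height_eq_exp:
  assumes "P \<noteq> 0"
  obtains h :: nat where "height P = exp (real h)"
proof -
  have "height P \<in> range (\<lambda>m. F_abs (coeff_vec P m))"
    unfolding height_def using finite_range_coeff_vec by (rule Max_in) blast
  then obtain m where m: "height P = F_abs (coeff_vec P m)" by blast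
  have "coeff_vec P m \<noteq> 0"
  proof
    assume "coeff_vec P m = 0"
    then have "coeff_vec P m' = 0" for m'
      using height_ge[of P m'] F_abs_nonneg[of "coeff_vec P m'"] unfolding m by (metis F_abs_eq_0_iff antisym)
    with coeff_vec_nonzero[OF assms] show False by auto
  qed
  then obtain h :: nat where "F_abs (coeff_vec P m) = exp (real h)"
    by (rule F_abs_range_of_Lambda[OF rangeI])
  with m that show thesis by simp
qed

lemma finite_degree_le: "finite {p :: 'q::{finite,field} poly. Polynomial.degree p \<le> h}"
proof (rule finite_imageD)
  show "finite ((\<lambda>p. restrict (coeff p) {..h}) ` {p :: 'q poly. Polynomial.degree p \<le> h})"
    by (rule finite_subset[of _ "PiE {..h} (\<lambda>_. UNIV)"]) (auto intro!: finite_PiE split: if_splits)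
  show "inj_on (\<lambda>p. restrict (coeff p) {..h}) {p :: 'q poly. Polynomial.degree p \<le> h}"
  proof (rule inj_onI)
    fix p q :: "'q poly"
    assume pq: "p \<in> {p. Polynomial.degree p \<le> h}" "q \<in> {p. Polynomial.degree p \<le> h}"
      and eq: "restrict (coeff p) {..h} = restrict (coeff q) {..h}"
    have "coeff p i = coeff q i" for i
    proof (cases "i \<le> h")
      case True
      with fun_cong[OF eq, of i] show ?thesis by simp
    next
      case False
      with pq show ?thesis by (simp add: coeff_eq_0)
    qed
    then show "p = q" by (rule poly_eqI)
  qed
qed

text \<open>A height bound limits the degrees of finitely many coefficients, each then having
  finitely many values over the finite field.\<close>

lemma finite_height_le:
  "finite {P :: ('q::{finite,field}, 'd::finite) mpolyL. total_degree_le k P \<and> height P \<le> exp (real h)}"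
  (is "finite ?S")
proof (rule finite_imageD)
  show "finite ((\<lambda>P. restrict (Poly_Mapping.lookup P) (expos k)) ` ?S)"
  proof (rule finite_subset[of _ "PiE (expos k) (\<lambda>_. {p. Polynomial.degree p \<le> h})"])
    show "(\<lambda>P. restrict (Poly_Mapping.lookup P) (expos k)) ` ?S
        \<subseteq> PiE (expos k) (\<lambda>_. {p. Polynomial.degree p \<le> h})"
    proof clarsimp
      fix P :: "('q, 'd) mpolyL" and m
      assume "height P \<le> exp (real h)"
      then have "F_abs (coeff_vec P m) \<le> exp (real h)"
        using height_ge[of P m] by simp
      then show "Polynomial.degree (Poly_Mapping.lookup P m) \<le> h"
        by (cases "Poly_Mapping.lookup P m = 0") (simp_all add: F_abs_of_Lambda)
    qed
  qed (intro finite_PiE finite_expos finite_degree_le)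
  show "inj_on (\<lambda>P. restrict (Poly_Mapping.lookup P) (expos k)) ?S"
  proof (rule inj_onI)
    fix P Q :: "('q, 'd) mpolyL"
    assume PQ: "P \<in> ?S" "Q \<in> ?S"
      and eq: "restrict (Poly_Mapping.lookup P) (expos k) = restrict (Poly_Mapping.lookup Q) (expos k)"
    have "Poly_Mapping.lookup P m = Poly_Mapping.lookup Q m" for m
    proof (cases "m \<in> expos k")
      case True
      with fun_cong[OF eq, of m] show ?thesis by simp
    next
      case False
      then have "m \<notin> Poly_Mapping.keys P" "m \<notin> Poly_Mapping.keys Q"
        using PQ by (auto simp: total_degree_le_keys)
      then show ?thesis by (simp add: in_keys_iff)
    qed
    then show "P = Q" by (rule poly_mapping_eqI)
  qed
qed

section \<open>Very well approximable points as limsup sets\<close>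

definition approximants :: "nat \<Rightarrow> real \<Rightarrow> 'q::{finite,field} fls ^ 'd::finite \<Rightarrow> ('q, 'd) mpolyL set" where
  "approximants k \<epsilon> x = {P. total_degree_le k P \<and>
     F_abs (eval_at P x) < height P powr (- (real (num_monoms k CARD('d)) + \<epsilon>))}"

definition approx_at :: "nat \<Rightarrow> real \<Rightarrow> nat \<Rightarrow> ('q::{finite,field} fls ^ 'd::finite) set" where
  "approx_at k \<epsilon> h = {x. \<exists>P\<in>approximants k \<epsilon> x. height P = exp (real h)}"

text \<open>The zero polynomial has height 0, and \<open>0 powr _\<close> is 0, which no absolute
  value undercuts.\<close>

lemma approximants_nonzero: "P \<in> approximants k \<epsilon> x \<Longrightarrow> P \<noteq> 0"
  using F_abs_nonneg[of "eval_at 0 x"] by (auto simp: approximants_def simp del: F_abs_nonneg)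

text \<open>Since each height bound admits finitely many polynomials, infinitely many solutions mean
  unbounded heights. This is the form to which Borel-Cantelli applies.\<close>

lemma infinite_approximants_iff:
  "infinite (approximants k \<epsilon> x) \<longleftrightarrow> (\<forall>n. \<exists>h\<ge>n. x \<in> approx_at k \<epsilon> h)"
proof
  assume inf: "infinite (approximants k \<epsilon> x)"
  show "\<forall>n. \<exists>h\<ge>n. x \<in> approx_at k \<epsilon> h"
  proof
    fix n
    have "infinite (approximants k \<epsilon> x - {P. total_degree_le k P \<and> height P \<le> exp (real n)})"
      using inf finite_height_le by (rule Diff_infinite_finite[rotated])
    from infinite_imp_nonempty[OF this] obtain P where P: "P \<in> approximants k \<epsilon> x"
        "P \<notin> {P. total_degree_le k P \<and> height P \<le> exp (real n)}"
      by blast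
    obtain h where h: "height P = exp (real h)"
      using height_eq_exp[OF approximants_nonzero[OF P(1)]] .
    have "n \<le> h"
      using P h by (auto simp: approximants_def)
    with h P(1) show "\<exists>h\<ge>n. x \<in> approx_at k \<epsilon> h"
      by (auto simp: approx_at_def)
  qed
next
  assume *: "\<forall>n. \<exists>h\<ge>n. x \<in> approx_at k \<epsilon> h"
  show "infinite (approximants k \<epsilon> x)"
  proof
    assume "finite (approximants k \<epsilon> x)"
    then have "finite (height ` approximants k \<epsilon> x)" by simp
    then obtain c where c: "\<And>P. P \<in> approximants k \<epsilon> x \<Longrightarrow> height P \<le> c"
      by (meson finite_imageI bdd_above_finite bdd_above.E imageI)
    obtain n :: nat where "c < real n"
      using reals_Archimedean2 by blast
    moreover obtain h where "h \<ge> n" "x \<in> approx_at k \<epsilon> h"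
      using * by blast
    moreover obtain P where "P \<in> approximants k \<epsilon> x" "height P = exp (real h)"
      using calculation(3) by (auto simp: approx_at_def)
    moreover have "real h \<le> exp (real h)"
      using exp_ge_add_one_self[of "real h"] by linarith
    ultimately show False
      using c[of P] by simp
  qed
qed

text \<open>Nonzero polynomials have height at least 1, so a smaller \<epsilon> weakens the
  inequality and countably many values of \<epsilon> suffice.\<close>

lemma very_well_approximable_iff:
  "very_well_approximable k x \<longleftrightarrow> (\<exists>i. infinite (approximants k (1 / real (Suc i)) x))"
proof
  assume "very_well_approximable k x"
  then obtain \<epsilon> where \<epsilon>: "\<epsilon> > 0" "infinite (approximants k \<epsilon> x)"
    by (auto simp: very_well_approximable_def approximants_def)
  obtain i where i: "1 / real (Suc i) < \<epsilon>"
    using nat_approx_posE[OF \<epsilon>(1)] .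
  have "approximants k \<epsilon> x \<subseteq> approximants k (1 / real (Suc i)) x"
  proof
    fix P assume P: "P \<in> approximants k \<epsilon> x"
    obtain h where h: "height P = exp (real h)"
      using height_eq_exp[OF approximants_nonzero[OF P]] .
    have "height P powr (- (real (num_monoms k CARD('b)) + \<epsilon>))
        \<le> height P powr (- (real (num_monoms k CARD('b)) + 1 / real (Suc i)))"
      using i h by (intro powr_mono) auto
    with P show "P \<in> approximants k (1 / real (Suc i)) x"
      by (auto simp: approximants_def)
  qed
  with \<epsilon>(2) show "\<exists>i. infinite (approximants k (1 / real (Suc i)) x)"
    using finite_subset by blast
next
  assume "\<exists>i. infinite (approximants k (1 / real (Suc i)) x)"
  then obtain i where "infinite (approximants k (1 / real (Suc i)) x)" ..
  then show "very_well_approximable k x"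
    unfolding very_well_approximable_def approximants_def
    by (intro exI[of _ "1 / real (Suc i)"]) simp
qed

section \<open>Null sets of a friendly measure\<close>

context
  fixes k :: nat
    and U :: "('q::{finite,field} fls ^ 'd::finite) set"
    and \<mu> :: "('q fls ^ 'd) measure"
  assumes U: "open U"
    and radon: "radon_measure \<mu>"
    and friendly: "friendly_on k U \<mu>"
begin

lemma sum_expos: "(\<Sum>r\<in>expos k. c r * monom_at r x) =
    c 0 + (\<Sum>r\<in>nonconst_expos k. c r * monom_at r (x :: 'q fls ^ 'd))"
proof -
  have "finite (nonconst_expos k :: 'd expo set)"
    using finite_expos[of k] by (simp add: expos_eq)
  moreover have "(0 :: 'd expo) \<notin> nonconst_expos k"
    by (simp add: nonconst_expos_def)
  ultimately show ?thesis
    by (simp add: expos_eq)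
qed

lemma good_monomials:
  obtains C \<alpha> where "C > 0" "\<alpha> > 0"
    and "\<And>c. good_fun C \<alpha> U \<mu> (\<lambda>x. \<Sum>r\<in>expos k. c r * monom_at r x)"
proof -
  obtain C \<alpha> where "C > 0" "\<alpha> > 0" "good_map C \<alpha> U \<mu> (nonconst_expos k) monom_at"
    using friendly by (auto simp: friendly_on_def)
  with that show thesis
    by (simp add: sum_expos good_map_def)
qed

text \<open>Continuity on \<open>U\<close> is part of \<open>good_fun\<close>, so it is read off
  from friendliness.\<close>

lemma continuous_on_eval_at:
  assumes "total_degree_le k P"
  shows "continuous_on U (eval_at P)"
proof -
  obtain C \<alpha> where "good_fun C \<alpha> U \<mu> (\<lambda>x. \<Sum>r\<in>expos k. coeff_vec P r * monom_at r x)"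
    by (rule good_monomials) (rule that)
  then have "continuous_on U (\<lambda>x. \<Sum>r\<in>expos k. coeff_vec P r * monom_at r x)"
    by (simp add: good_fun_def)
  moreover have "(\<lambda>x. \<Sum>r\<in>expos k. coeff_vec P r * monom_at r x) = eval_at P"
    by (rule ext) (rule eval_at_eq[OF assms, symmetric])
  ultimately show ?thesis
    by (rule back_subst[of "continuous_on U"])
qed

lemma open_approx_at: "open (U \<inter> approx_at k \<epsilon> h)"
proof -
  have "U \<inter> approx_at k \<epsilon> h = (\<Union>P\<in>{P. total_degree_le k P \<and> height P = exp (real h)}.
      {x \<in> U. F_abs (eval_at P x) < height P powr (- (real (num_monoms k CARD('d)) + \<epsilon>))})"
    by (auto simp: approx_at_def approximants_def)
  moreover have "open \<dots>"
    by (intro open_UN ballI open_F_abs_sublevel[OF continuous_on_eval_at U]) auto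
  ultimately show ?thesis by simp
qed

text \<open>At time \<open>t = h + s\<close> the coefficients are contracted to \<open>e\<^bsup>h-t\<^esup> = e\<^bsup>-s\<^esup>\<close>, and the value at \<open>x\<close> has
  become at most \<open>e\<^bsup>Nt-(N+\<epsilon>)h\<^esup> = e\<^bsup>Ns-\<epsilon>h\<^esup>\<close>.\<close>

lemma short_vector:
  fixes h s :: nat and \<epsilon> :: real and x :: "'q fls ^ 'd"
  assumes x: "x \<in> approx_at k \<epsilon> h"
    and s: "(real (num_monoms k CARD('d)) + 1) * real s \<le> \<epsilon> * real h"
  defines "n \<equiv> card (expos k :: 'd expo set) - 1"
  defines "w0 \<equiv> fls_X_inv ^ (n * (h + s)) :: 'q fls" and "w1 \<equiv> fls_X ^ (h + s) :: 'q fls"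
  shows "twist (expos k :: 'd expo set) w0 w1"
    and "\<exists>v. int_vec (expos k) v \<and> v \<noteq> (\<lambda>_. 0) \<and>
      twist.vnorm (expos k) monom_at w0 w1 x v \<le> exp (- real s)"
proof -
  have abs_w0: "F_abs w0 = exp (real (n * (h + s)))" and abs_w1: "F_abs w1 = exp (- real (h + s))"
    by (simp_all add: w0_def w1_def F_abs_power F_abs_fls_X F_abs_fls_X_inv exp_of_nat_mult[symmetric]
        flip: exp_of_nat_mult)
  show tw: "twist (expos k :: 'd expo set) w0 w1"
  proof
    show "finite (expos k :: 'd expo set)"
      by (rule finite_expos)
    show "w1 \<noteq> 0"
      by (simp add: w1_def)
    fix j assume j: "1 \<le> j" "j \<le> card (expos k :: 'd expo set)"
    then have "real (j - 1) * real (h + s) \<le> real (n * (h + s))"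
      unfolding of_nat_mult[symmetric] of_nat_le_iff n_def by (intro mult_right_mono) auto
    then show "1 \<le> F_abs w0 * F_abs w1 ^ (j - 1)"
      unfolding abs_w0 abs_w1 exp_of_nat_mult[symmetric] exp_add[symmetric]
      by (simp add: algebra_simps)
  qed
  interpret twist "expos k :: 'd expo set" monom_at w0 w1
    by (rule tw)
  obtain P where P: "P \<in> approximants k \<epsilon> x" "height P = exp (real h)"
    using x by (auto simp: approx_at_def)
  define N where "N = real (num_monoms k CARD('d))"
  have deg: "total_degree_le k P"
    and small: "F_abs (eval_at P x) \<le> exp (- real h * (N + \<epsilon>))"
    using P by (auto simp: approximants_def N_def powr_def algebra_simps)
  have "card (expos k :: 'd expo set) - 1 \<le> ((k + CARD('d)) choose CARD('d)) - 1"
    by (rule diff_le_mono[OF card_expos])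
  then have n_le: "real n \<le> N"
    by (simp add: n_def N_def num_monoms_def)
  show "\<exists>v. int_vec (expos k) v \<and> v \<noteq> (\<lambda>_. 0) \<and> vnorm x v \<le> exp (- real s)"
  proof (intro exI conjI)
    show "int_vec (expos k) (coeff_vec P)" "coeff_vec P \<noteq> (\<lambda>_. 0)"
      using int_vec_coeff_vec[OF deg] coeff_vec_nonzero[OF approximants_nonzero[OF P(1)]] by auto
    show "vnorm x (coeff_vec P) \<le> exp (- real s)"
    proof (rule vnorm_le)
      have "F_abs w0 * F_abs (eval_at P x) \<le> exp (real (n * (h + s))) * exp (- real h * (N + \<epsilon>))"
        unfolding abs_w0 using small by (intro mult_left_mono) auto
      also have "\<dots> = exp (real n * (real h + real s) - real h * (N + \<epsilon>))"
        by (simp flip: exp_add)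
      also have "\<dots> \<le> exp (- real s)"
      proof -
        have "real n * (real h + real s) \<le> N * (real h + real s)"
          using n_le by (intro mult_right_mono) auto
        then show ?thesis
          using s unfolding N_def[symmetric] by (simp add: algebra_simps)
      qed
      finally show "F_abs w0 * F_abs (\<Sum>r\<in>expos k. coeff_vec P r * monom_at r x) \<le> exp (- real s)"
        using eval_at_eq[OF deg] by simp
      fix r
      have "F_abs w1 * F_abs (coeff_vec P r) \<le> exp (- real (h + s)) * exp (real h)"
        unfolding abs_w1 using height_ge[of P r] P(2) by (intro mult_left_mono) auto
      also have "\<dots> = exp (- real s)"
        by (simp flip: exp_add)
      finally show "F_abs w1 * F_abs (coeff_vec P r) \<le> exp (- real s)" .
    qed
  qed
qed

text \<open>At height \<open>e^h\<close> the contraction reaches \<open>e^(-s)\<close> with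
  \<open>s\<close> of order \<open>h / \<kappa>\<close>, so nondivergence bounds the measures by a
  geometric sequence in \<open>h\<close>.\<close>

lemma approximable_null_on_ball:
  fixes x0 :: "'q fls ^ 'd"
  assumes \<epsilon>: "\<epsilon> > 0" and x0: "x0 \<in> msupp \<mu>" "expball x0 n0 \<subseteq> U"
  shows "\<exists>A\<in>null_sets \<mu>. {x \<in> expball x0 n0 \<inter> msupp \<mu>. infinite (approximants k \<epsilon> x)} \<subseteq> A"
proof -
  obtain C \<alpha> where good: "C > 0" "\<alpha> > 0"
      "\<And>c. good_fun C \<alpha> U \<mu> (\<lambda>x. \<Sum>r\<in>expos k. c r * monom_at r x)"
    by (rule good_monomials) (rule that)
  have nonplanar: "\<forall>r\<in>expos k. c r = 0"
    if zero: "\<And>y. y \<in> expball x0 n0 \<inter> msupp \<mu> \<Longrightarrow> (\<Sum>r\<in>expos k. c r * monom_at r y) = 0" for c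
  proof -
    have "nonplanar_map U \<mu> (nonconst_expos k) monom_at"
      using friendly by (simp add: friendly_on_def)
    from this[unfolded nonplanar_map_def, rule_format, OF x0(1), of "6 / 5 * exp (real_of_int n0)" "c 0" c]
    have "c 0 = 0 \<and> (\<forall>i\<in>nonconst_expos k. c i = 0)"
      using x0(2) zero unfolding expball_eq_supball[symmetric] sum_expos by auto
    then show ?thesis
      by (simp add: expos_eq)
  qed
  have zero: "(0 :: 'd expo) \<in> expos k"
    by (simp add: expos_def)
  have federer: "federer_on U \<mu>"
    using friendly by (simp add: friendly_on_def)
  obtain K \<rho> where K: "K < \<infinity>" and \<rho>: "0 < \<rho>" "\<rho> \<le> 1"
    and nondiv: "\<And>w0 w1 \<epsilon>. twist (expos k :: 'd expo set) w0 w1 \<Longrightarrow> 0 < \<epsilon> \<Longrightarrow> \<epsilon> \<le> \<rho> \<Longrightarrow> \<exists>A\<in>sets \<mu>.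
      {y \<in> expball x0 n0 \<inter> msupp \<mu>. \<exists>v. int_vec (expos k) v \<and> v \<noteq> (\<lambda>_. 0) \<and>
        twist.vnorm (expos k) monom_at w0 w1 y v < \<epsilon>} \<subseteq> A \<and>
      emeasure \<mu> A \<le> K * ennreal (\<epsilon> powr \<alpha>)"
    by (rule quantitative_nondivergence[OF U radon federer good(3,1,2) finite_expos zero monom_at_0 x0])
      (rule nonplanar, assumption, rule that, assumption+)
  define N where "N = real (num_monoms k CARD('d)) + 1"
  \<comment> \<open>\<open>s h\<close> must grow linearly while \<open>N * s h\<close> stays below
    \<open>\<epsilon> * h\<close>. This \<kappa> leaves half of \<open>\<epsilon> * h\<close> to the
    quotient \<open>h div \<kappa>\<close>; the rounding term 1 takes the other half once
    \<open>h \<ge> h1\<close>.\<close>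
  obtain \<kappa> :: nat where \<kappa>: "2 * N / \<epsilon> < real \<kappa>"
    using reals_Archimedean2 by blast
  have N: "N \<ge> 1"
    by (simp add: N_def)
  then have \<kappa>0: "\<kappa> > 0"
    using \<kappa> \<epsilon> by (cases "\<kappa> = 0") (auto simp: field_simps)
  define s where "s h = h div \<kappa> + 1" for h
  define h1 where "h1 = nat \<lceil>2 * N / \<epsilon>\<rceil>"
  have s_ge: "real h / real \<kappa> \<le> real (s h)" for h
  proof -
    have "h \<le> \<kappa> * (h div \<kappa> + 1)"
      using dividend_less_div_times[OF \<kappa>0, of h] by (simp add: mult.commute)
    then have "real h \<le> real \<kappa> * real (s h)"
      unfolding s_def of_nat_mult[symmetric] of_nat_le_iff .
    then show ?thesis
      using \<kappa>0 by (simp add: field_simps)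
  qed
  have s_le: "N * real (s h) \<le> \<epsilon> * real h" if "h \<ge> h1" for h
  proof -
    have "real (h div \<kappa>) \<le> real h / real \<kappa>"
      using \<kappa>0 div_times_less_eq_dividend[of h \<kappa>] by (simp add: field_simps flip: of_nat_mult)
    also have "\<dots> \<le> real h * \<epsilon> / (2 * N)"
    proof -
      have "2 * N * real h \<le> \<epsilon> * real \<kappa> * real h"
        using \<kappa> \<epsilon> by (intro mult_right_mono) (auto simp: field_simps)
      then show ?thesis
        using \<kappa>0 N by (simp add: field_simps)
    qed
    finally have "2 * N * real (h div \<kappa>) \<le> \<epsilon> * real h"
      using N by (simp add: field_simps)
    moreover have "2 * N / \<epsilon> \<le> real h"
      using that unfolding h1_def by linarith
    then have "2 * N \<le> \<epsilon> * real h"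
      using \<epsilon> by (simp add: field_simps)
    ultimately show ?thesis
      by (simp add: s_def algebra_simps)
  qed
  have "(\<lambda>h. 2 * exp (- real h / real \<kappa>)) \<longlonglongrightarrow> 0"
    using \<kappa>0 by real_asymp
  then have "\<forall>\<^sub>F h in sequentially. 2 * exp (- real h / real \<kappa>) < \<rho>"
    using \<rho>(1) by (rule order_tendstoD)
  then obtain h2 where h2: "\<And>h. h \<ge> h2 \<Longrightarrow> 2 * exp (- real h / real \<kappa>) < \<rho>"
    by (auto simp: eventually_sequentially)
  define bad where "bad h = {y \<in> expball x0 n0 \<inter> msupp \<mu>. y \<in> approx_at k \<epsilon> h}" for h
  \<comment> \<open>The factor 2 makes the inequality strict, as \<open>short_vector\<close> gives
    only \<open>\<le>\<close> and nondivergence asks for \<open><\<close>.\<close>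
  define bnd where "bnd h = 2 * exp (- real h / real \<kappa>)" for h :: nat
  have cover: "\<exists>A\<in>sets \<mu>. bad h \<subseteq> A \<and> emeasure \<mu> A \<le> K * ennreal (bnd h powr \<alpha>)"
    if h: "h \<ge> max h1 h2" for h
  proof -
    let ?n = "card (expos k :: 'd expo set) - 1"
    let ?w0 = "fls_X_inv ^ (?n * (h + s h)) :: 'q fls" and ?w1 = "fls_X ^ (h + s h) :: 'q fls"
    show ?thesis
    \<comment> \<open>The twist conditions come from \<open>short_vector\<close>, which assumes a
      point of \<open>approx_at k \<epsilon> h\<close>.\<close>
    proof (cases "bad h = {}")
      case True
      then show ?thesis by (intro bexI[of _ "{}"]) auto
    next
      case False
      have sh: "(real (num_monoms k CARD('d)) + 1) * real (s h) \<le> \<epsilon> * real h"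
        using s_le[of h] h by (simp add: N_def)
      have tw: "twist (expos k :: 'd expo set) ?w0 ?w1"
        using False short_vector(1)[OF _ sh] by (auto simp: bad_def)
      have "exp (- real (s h)) \<le> exp (- real h / real \<kappa>)"
        using s_ge[of h] by simp
      then have lt: "exp (- real (s h)) < bnd h"
        using exp_gt_zero[of "- real h / real \<kappa>"] unfolding bnd_def by linarith
      have "bnd h > 0" "bnd h \<le> \<rho>"
        using h2[of h] h by (auto simp: bnd_def)
      from nondiv[OF tw this] obtain A where A: "A \<in> sets \<mu>"
        "{y \<in> expball x0 n0 \<inter> msupp \<mu>. \<exists>v. int_vec (expos k) v \<and> v \<noteq> (\<lambda>_. 0) \<and>
          twist.vnorm (expos k) monom_at ?w0 ?w1 y v < bnd h} \<subseteq> A"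
        "emeasure \<mu> A \<le> K * ennreal (bnd h powr \<alpha>)"
        by blast
      have "bad h \<subseteq> A"
      proof
        fix y assume y: "y \<in> bad h"
        then have "y \<in> approx_at k \<epsilon> h"
          by (simp add: bad_def)
        from short_vector(2)[OF this sh] obtain v where "int_vec (expos k) v" "v \<noteq> (\<lambda>_. 0)"
            "twist.vnorm (expos k) monom_at ?w0 ?w1 y v \<le> exp (- real (s h))"
          by blast
        with lt y show "y \<in> A"
          by (intro subsetD[OF A(2)]) (force simp: bad_def)
      qed
      with A show ?thesis by blast
    qed
  qed
  define A where "A h = (if h \<ge> max h1 h2
    then SOME A. A \<in> sets \<mu> \<and> bad h \<subseteq> A \<and> emeasure \<mu> A \<le> K * ennreal (bnd h powr \<alpha>) else {})" for h
  have A: "A h \<in> sets \<mu> \<and> bad h \<subseteq> A h \<and> emeasure \<mu> (A h) \<le> K * ennreal (bnd h powr \<alpha>)"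
    if "h \<ge> max h1 h2" for h
    using someI_ex[of "\<lambda>A. A \<in> sets \<mu> \<and> bad h \<subseteq> A \<and> emeasure \<mu> A \<le> K * ennreal (bnd h powr \<alpha>)"]
      cover[OF that] that unfolding A_def by (simp add: Bex_def)
  have A_sets: "A h \<in> sets \<mu>" for h
    using A[of h] by (cases "h \<ge> max h1 h2") (auto simp: A_def)
  obtain K' :: real where K': "K' \<ge> 0" "K = ennreal K'"
    using K by (cases K) auto
  have A_le: "emeasure \<mu> (A h) \<le> ennreal (K' * bnd h powr \<alpha>)" for h
    using A[of h] K' by (cases "h \<ge> max h1 h2") (auto simp: A_def ennreal_mult)
  have "limsup A \<in> null_sets \<mu>"
  proof (rule borel_cantelli_limsup1[OF A_sets])
    show "emeasure \<mu> (A h) < \<infinity>" for h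
      using A_le[of h] by (simp add: le_less_trans)
    define q where "q = exp (- \<alpha> / real \<kappa>)"
    have q: "0 \<le> q" "q < 1"
      using good(2) \<kappa>0 by (auto simp: q_def)
    have bnd_eq: "bnd h powr \<alpha> = 2 powr \<alpha> * q ^ h" for h
      by (simp add: bnd_def q_def powr_mult exp_powr_real mult_ac flip: exp_of_nat_mult)
    show "summable (\<lambda>h. measure \<mu> (A h))"
    proof (rule summable_comparison_test')
      show "summable (\<lambda>h. K' * (2 powr \<alpha> * q ^ h))"
        using q by (intro summable_mult summable_geometric) auto
      show "norm (measure \<mu> (A h)) \<le> K' * (2 powr \<alpha> * q ^ h)" if "h \<ge> 0" for h
        using A_le[of h] K'(1) q(1) unfolding bnd_eq measure_def
        by (simp add: enn2real_leI)
    qed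
  qed
  moreover have "{x \<in> expball x0 n0 \<inter> msupp \<mu>. infinite (approximants k \<epsilon> x)} \<subseteq> limsup A"
  proof
    fix x assume x: "x \<in> {x \<in> expball x0 n0 \<inter> msupp \<mu>. infinite (approximants k \<epsilon> x)}"
    have "\<exists>h\<ge>m. x \<in> A h" for m
    proof -
      obtain h where h: "h \<ge> max m (max h1 h2)" "x \<in> approx_at k \<epsilon> h"
        using x infinite_approximants_iff by blast
      then have "x \<in> bad h"
        using x by (simp add: bad_def)
      with A[of h] h show ?thesis by auto
    qed
    then show "x \<in> limsup A"
      by (auto simp: limsup_INF_SUP)
  qed
  ultimately show ?thesis by blast
qed

text \<open>The ball estimate concerns points of the support; the rest of each ball is null by
  \<open>radon_measure_off_msupp\<close>. Measurability holds because the set is a limsup of the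
  open sets \<open>G h\<close>.\<close>

lemma approximable_null:
  assumes "\<epsilon> > 0"
  shows "{x \<in> U. infinite (approximants k \<epsilon> x)} \<in> null_sets \<mu>"
proof -
  define E where "E = {x \<in> U. infinite (approximants k \<epsilon> x)}"
  have sets: "sets \<mu> = sets borel"
    using radon by (simp add: radon_measure_def)
  define G where "G h = U \<inter> approx_at k \<epsilon> h" for h
  have [measurable]: "G h \<in> sets borel" for h
    unfolding G_def by (rule borel_open[OF open_approx_at])
  have "E = (\<Inter>n. \<Union>h\<in>{n..}. G h)"
    unfolding E_def G_def infinite_approximants_iff by auto
  moreover have "(\<Inter>n. \<Union>h\<in>{n..}. G h) \<in> sets borel"
    by measurable
  ultimately have E: "E \<in> sets borel"
    by simp
  have "emeasure \<mu> E = 0"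
  proof (rule radon_measure_locally_null[OF radon E])
    fix x assume "x \<in> E"
    then have "x \<in> U" by (simp add: E_def)
    then obtain n :: nat where n: "expball x (- int n) \<subseteq> U"
      using open_contains_expball[OF U] by blast
    define B where "B = expball x (- int n)"
    show "\<exists>V. open V \<and> x \<in> V \<and> emeasure \<mu> (E \<inter> V) = 0"
    proof (cases "x \<in> msupp \<mu>")
      case False
      then obtain V where V: "open V" "x \<in> V" "emeasure \<mu> V = 0"
        by (auto simp: msupp_def not_gr_zero)
      have "emeasure \<mu> (E \<inter> V) \<le> emeasure \<mu> V"
        using V(1) by (intro emeasure_mono) (auto simp: sets)
      with V show ?thesis
        by (intro exI[of _ V]) auto
    next
      case True
      obtain A where A: "A \<in> null_sets \<mu>"
          "{x \<in> B \<inter> msupp \<mu>. infinite (approximants k \<epsilon> x)} \<subseteq> A"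
        using approximable_null_on_ball[OF assms True n] unfolding B_def by blast
      have "B \<in> sets borel"
        unfolding B_def by (rule borel_open[OF open_expball])
      moreover have "B - msupp \<mu> = B \<inter> - msupp \<mu>" by blast
      ultimately have "B - msupp \<mu> \<in> null_sets \<mu>"
        using radon_measure_off_msupp[OF radon, of B] open_Compl_msupp[of \<mu>]
        by (simp add: null_sets_def sets)
      with A(1) have "A \<union> (B - msupp \<mu>) \<in> null_sets \<mu>"
        by (rule null_sets.Un)
      moreover have "E \<inter> B \<subseteq> A \<union> (B - msupp \<mu>)"
        using A(2) by (auto simp: E_def)
      moreover have "E \<inter> B \<in> sets \<mu>"
        using E \<open>B \<in> sets borel\<close> by (simp add: sets)
      ultimately have "E \<inter> B \<in> null_sets \<mu>"
        using null_sets_subset by blast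
      then show ?thesis
        unfolding B_def using open_expball expball_self by (intro exI[of _ "expball x (- int n)"]) auto
    qed
  qed
  with E show ?thesis
    by (simp add: E_def null_sets_def sets)
qed

end

theorem theorem3p1:
  fixes k :: nat
    and U :: "('q::{finite,field} fls ^ 'd::finite) set"
    and \<mu> :: "('q fls ^ 'd) measure"
  assumes "open U"
    and "radon_measure \<mu>"
    and "emeasure \<mu> U > 0"
    and "friendly_on k U \<mu>"
  shows "{x \<in> U. very_well_approximable k x} \<in> null_sets \<mu>"
proof -
  have "(\<Union>i. {x \<in> U. infinite (approximants k (1 / real (Suc i)) x)}) \<in> null_sets \<mu>"
    by (intro null_sets_UN approximable_null[OF assms(1,2,4)]) simp
  moreover have "{x \<in> U. very_well_approximable k x} =
      (\<Union>i. {x \<in> U. infinite (approximants k (1 / real (Suc i)) x)})"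
    by (auto simp: very_well_approximable_iff)
  ultimately show ?thesis by simp
qed

end
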